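(* Let $\alpha>1$ be a fixed irrational number of finite type $\tau<\infty$ and let $\beta\in\mathbb{R}$ be a fixed real number. Then there is a constant $\varepsilon>0$ such that for all integers $c,d$ with $0\le c<d\ll N^{1/(2\tau+2)-\varepsilon}$ and $\gcd(c,d)=1$, and all sufficiently large integers $N$, \[ \sum_{n\leq N}\Lambda\big(d[\alpha n+\beta]+c\big)=\alpha^{-1}\sum_{m\leq [\alpha N+\beta]}\Lambda(dm+c)+O\!\left(N^{1-\varepsilon}\right), \] where the implied constant depends only on $\alpha$, $\beta$ and $\varepsilon$ (when $\beta=0$ the dependence on $\beta$ may be removed).
   Context: $\Lambda$ is the von Mangoldt function (with $\Lambda(n)=0$ for $n\le 1$), and $[x]$ denotes the greatest integer not exceeding $x$. For a real $x$, $\|x\|$ denotes the distance from $x$ to the nearest integer. The type of an irrational number $\alpha$ is $\tau=\sup\{\theta\in\mathbb{R}: \liminf_{q\to\infty,\,q\in\mathbb{Z}^+} q^{\theta}\|\alpha q\|=0\}$; $\alpha$ is of finite type if $\tau<\infty$. The notation $d\ll X$ means $d\le C X$ for a fixed constant $C>0$. *)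

theory Defs
  imports "HOL-Analysis.Analysis" "HOL-Number_Theory.Prime_Powers"
begin

definition dist_nearest_int :: "real \<Rightarrow> real" where
  "dist_nearest_int x = \<bar>x - of_int (round x)\<bar>"

(* The liminf and the supremum are taken in the extended reals, so the value
   \<infinity> (a Liouville number) is possible. The junk value at q = 0 does not
   affect the liminf. *)
definition diophantine_type :: "real \<Rightarrow> ereal" where
  "diophantine_type \<alpha> =
     Sup (ereal ` {\<theta>. liminf (\<lambda>q::nat. ereal (real q powr \<theta> * dist_nearest_int (\<alpha> * real q))) = 0})"

(* The von Mangoldt function on the integers: nat sends every negative integer to 0,
   and mangoldt vanishes at 0 and 1. *)
definition mangoldt_int :: "int \<Rightarrow> real" where
  "mangoldt_int k = mangoldt (nat k)"

end

theory Submission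
  imports Defs "HOL-Number_Theory.Cong" "HOL-Computational_Algebra.Squarefree"
    "HOL-Real_Asymp.Real_Asymp"
begin

text \<open>
  Write \<open>\<gamma> = 1/\<alpha>\<close>. An integer \<open>m\<close> is a Beatty value \<open>\<lfloor>\<alpha> n + \<beta>\<rfloor>\<close> iff the fractional part of
  \<open>\<gamma> (\<beta> - m)\<close> is less than \<open>\<gamma>\<close>, so the claim says that the points \<open>\<gamma> (\<beta> - m)\<close>, weighted by
  \<open>\<Lambda>(d m + c)\<close>, are equidistributed modulo 1. An Erdos-Turan type inequality, with the Fejer kernel
  sampled at the points \<open>r/H\<close>, reduces this to a power saving in the sums of
  \<open>\<Lambda>(d m + c) e(k \<gamma> m)\<close> for \<open>k < H\<close>, where \<open>H\<close> is a tiny power of \<open>N\<close>.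

  These sums are treated by Vaughan's identity directly inside the progression. In the bilinear part,
  the congruence \<open>a m \<equiv> c (mod d)\<close> puts both \<open>a\<close> and \<open>m - m'\<close> in residue classes modulo \<open>d\<close>, so that
  only \<open>\<parallel>k \<gamma> j\<parallel>\<close> and \<open>\<parallel>k \<gamma> d j\<parallel>\<close> with \<open>j \<le> L\<close> enter, \<open>L\<close> again being a tiny power of \<open>N\<close>.
  The finite type of \<open>\<alpha>\<close> bounds these from below by powers \<open>(k d j) powr (- \<tau> - \<eta>)\<close>, and no rational
  approximation to \<open>\<gamma>\<close> is needed. The loss is about \<open>d powr (\<tau> + 2)\<close>, which for
  \<open>d \<le> N powr (1/(2\<tau>+2))\<close> is at most \<open>N powr (3/4)\<close>. Hence the saving does not depend on how close
  \<open>d\<close> is to the limit, and the same \<open>\<epsilon>\<close> can serve in the range of \<open>d\<close> and in the error term.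
\<close>

section \<open>Exponential sums over residue classes\<close>

text \<open>The progression up to X = d M + c has only about X/d terms, and d may be a power of N,
  so a saving relative to X itself would be worthless; every estimate below is stated relative to
  X/d.

  Rational approximations are replaced by a pigeonhole on runs of L consecutive phases: resonant
  terms thin out by a factor L, all others cost O(1/\<delta>). With spacing \<open>\<delta>1\<close>
  in type I and \<open>\<delta>2\<close> in type II sums, this works as long as d^2 L^3 / (\<delta>1
  \<delta>2) stays below a constant times the number M of terms. Up to tiny powers of N the left
  side is d^(\<tau> + 2). With \<sigma> = 1/(2\<tau> + 2), the exponent \<sigma>(\<tau> + 2) equals
  1/2 + \<sigma>, which is at most 3/4 because Dirichlet's theorem forces \<tau> \<ge> 1. The
  remaining N^(1/4) pays for all powers of H and L.

  The Fejer kernel is nonnegative and its shifts by r/H add up to exactly H. It thus yields upper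
  bounds for nonnegative weights; the lower bounds come from the complementary interval.\<close>

abbreviation expi :: "real \<Rightarrow> complex" where
  "expi x \<equiv> cis (2 * pi * x)"

section \<open>Distance to the nearest integer and geometric sums\<close>

lemma dist_nearest_int_nonneg: "0 \<le> dist_nearest_int x"
  by (simp add: dist_nearest_int_def)

lemma dist_nearest_int_le: "dist_nearest_int x \<le> \<bar>x - of_int k\<bar>"
  unfolding dist_nearest_int_def by (rule round_diff_minimal)

lemma dist_nearest_int_le_half: "dist_nearest_int x \<le> 1 / 2"
  using of_int_round_abs_le[of x] by (simp add: dist_nearest_int_def abs_minus_commute)

lemma dist_nearest_int_uminus [simp]: "dist_nearest_int (- x) = dist_nearest_int x"
proof -
  have "dist_nearest_int (- y) \<le> dist_nearest_int y" for y
  proof -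
    have "dist_nearest_int (- y) \<le> \<bar>- y - of_int (- round y)\<bar>"
      by (rule dist_nearest_int_le)
    also have "\<dots> = dist_nearest_int y"
      unfolding dist_nearest_int_def by simp
    finally show ?thesis .
  qed
  from this[of x] this[of "- x"] show ?thesis by simp
qed

lemma dist_nearest_int_diff:
  "dist_nearest_int (x - y) \<le> dist_nearest_int x + dist_nearest_int y"
proof -
  have "dist_nearest_int (x - y) \<le> \<bar>(x - y) - of_int (round x - round y)\<bar>"
    by (rule dist_nearest_int_le)
  also have "\<dots> \<le> dist_nearest_int x + dist_nearest_int y"
    unfolding dist_nearest_int_def by simp
  finally show ?thesis .
qed

lemma norm_cis_minus_1: "norm (cis t - 1) = 2 * \<bar>sin (t / 2)\<bar>"
proof -
  have "(norm (cis t - 1))\<^sup>2 = (cos t - 1)\<^sup>2 + (sin t)\<^sup>2"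
    by (simp add: cmod_power2)
  also have "\<dots> = 2 - 2 * cos t"
    using sin_cos_squared_add[of t] by (simp add: power2_eq_square algebra_simps)
  also have "\<dots> = (2 * \<bar>sin (t / 2)\<bar>)\<^sup>2"
  proof -
    have "cos t = 1 - 2 * (sin (t / 2))\<^sup>2" using cos_double_sin[of "t / 2"] by simp
    thus ?thesis by (simp add: power_mult_distrib)
  qed
  finally show ?thesis
    by (rule power2_eq_imp_eq) auto
qed

text \<open>For t = pi x < 2 the Taylor bound t - t^3/6 keeps a share 1 - t^2/6 \<ge> 1/3 of t, and
  pi/3 > 1.\<close>

lemma sin_pi_ge:
  assumes "0 \<le> x" "x \<le> 1 / 2"
  shows "x \<le> sin (pi * x)"
proof -
  have px: "0 \<le> pi * x" "pi * x \<le> pi * (1/2)"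
    using assms by (auto intro!: mult_left_mono)
  have "pi * x \<le> 2"
    using px pi_half_less_two by linarith
  hence "(pi * x)\<^sup>2 \<le> 2\<^sup>2"
    using px by (intro power_mono) auto
  hence sq: "(pi * x)\<^sup>2 / 6 \<le> 2 / 3" by simp
  have "\<bar>sin (pi * x) - pi * x\<bar> \<le> (pi * x)^3 / 6"
    using Maclaurin_sin_bound[of "pi * x" 3] px
    by (simp add: eval_nat_numeral sin_coeff_def field_simps)
  hence "sin (pi * x) \<ge> pi * x - (pi * x)^3 / 6" by linarith
  also have "pi * x - (pi * x)^3 / 6 = pi * x * (1 - (pi * x)\<^sup>2 / 6)"
    by (simp add: power2_eq_square power3_eq_cube algebra_simps)
  also have "\<dots> \<ge> pi * x * (1 / 3)"
    using sq px by (intro mult_left_mono) auto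
  also have "pi * x * (1 / 3) \<ge> x"
    using mult_right_mono[OF less_imp_le[OF pi_gt3] assms(1)] by simp
  finally show ?thesis by simp
qed

lemma norm_expi_minus_1_ge: "2 * dist_nearest_int x \<le> norm (expi x - 1)"
proof -
  define y where "y = x - of_int (round x)"
  have "expi x = expi y"
  proof -
    have "expi x = expi y * expi (of_int (round x))"
      by (simp add: cis_mult y_def algebra_simps)
    thus ?thesis by simp
  qed
  hence "norm (expi x - 1) = 2 * \<bar>sin (pi * y)\<bar>"
    using norm_cis_minus_1[of "2 * pi * y"] by simp
  also have "\<bar>sin (pi * y)\<bar> = \<bar>sin (pi * \<bar>y\<bar>)\<bar>"
    by (simp add: abs_if)
  finally have "norm (expi x - 1) = 2 * \<bar>sin (pi * \<bar>y\<bar>)\<bar>" .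
  moreover have "\<bar>sin (pi * \<bar>y\<bar>)\<bar> \<ge> \<bar>y\<bar>"
    using sin_pi_ge[of "\<bar>y\<bar>"] dist_nearest_int_le_half[of x]
    by (simp add: dist_nearest_int_def y_def)
  ultimately show ?thesis by (simp add: dist_nearest_int_def y_def)
qed

lemma norm_sum_expi_le:
  assumes "dist_nearest_int x \<noteq> 0"
  shows "norm (\<Sum>q = a..<b. expi (x * real q)) \<le> 1 / dist_nearest_int x"
proof -
  have pos: "dist_nearest_int x > 0"
    using assms dist_nearest_int_nonneg[of x] by linarith
  have ne: "expi x \<noteq> 1"
    using norm_expi_minus_1_ge[of x] pos by auto
  have "expi (x * real q) = expi x ^ q" for q
    by (subst Complex.DeMoivre) (simp add: mult_ac)
  hence "(\<Sum>q = a..<b. expi (x * real q)) = (\<Sum>q = a..<b. expi x ^ q)"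
    by simp
  also have "norm \<dots> \<le> 2 / norm (expi x - 1)"
  proof (cases "a \<le> b")
    case True
    have "(\<Sum>q = a..<b. expi x ^ q) * (expi x - 1) = expi x ^ b - expi x ^ a"
    proof -
      have "(\<Sum>q = a..<b. expi x ^ q) = (\<Sum>q<b. expi x ^ q) - (\<Sum>q<a. expi x ^ q)"
        using sum_diff_nat_ivl[of 0 a b "\<lambda>q. expi x ^ q"] True by (simp add: atLeast0LessThan)
      also have "\<dots> = (expi x ^ b - 1) / (expi x - 1) - (expi x ^ a - 1) / (expi x - 1)"
        by (simp only: geometric_sum[OF ne])
      finally show ?thesis using ne by (simp add: field_simps)
    qed
    hence "norm (\<Sum>q = a..<b. expi x ^ q) * norm (expi x - 1) = norm (expi x ^ b - expi x ^ a)"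
      by (metis norm_mult)
    also have "\<dots> \<le> norm (expi x ^ b) + norm (expi x ^ a)" by (rule norm_triangle_ineq4)
    also have "\<dots> = 2" by (simp add: norm_power)
    finally show ?thesis using ne by (simp add: field_simps)
  qed auto
  also have "\<dots> \<le> 2 / (2 * dist_nearest_int x)"
    using norm_expi_minus_1_ge[of x] pos by (intro divide_left_mono) (auto intro!: mult_pos_pos simp: ne)
  finally show ?thesis by simp
qed

section \<open>Residue classes inside intervals\<close>

lemma nat_interval_preimage:
  fixes d r i j :: nat
  assumes "d > 0"
  shows "\<exists>a b. {q. i \<le> d * q + r \<and> d * q + r \<le> j} = {a..<b} \<and> (a < b \<longrightarrow> d * (b - 1 - a) \<le> j - i)"
proof (cases "{q. i \<le> d * q + r \<and> d * q + r \<le> j} = {}")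
  case True
  thus ?thesis by (intro exI[of _ 0]) auto
next
  case False
  define Q where "Q = {q. i \<le> d * q + r \<and> d * q + r \<le> j}"
  have "q \<le> j" if "q \<in> Q" for q
  proof -
    have "q \<le> d * q" using assms by simp
    thus ?thesis using that unfolding Q_def by (metis (no_types, lifting) add_leD1 le_trans mem_Collect_eq)
  qed
  hence fin: "finite Q" by (meson finite_nat_set_iff_bounded_le)
  have ne: "Q \<noteq> {}" using False by (simp add: Q_def)
  have mm: "Min Q \<in> Q" "Max Q \<in> Q" using fin ne by auto
  have "Q = {Min Q..<Suc (Max Q)}"
  proof (intro set_eqI iffI)
    fix q assume "q \<in> {Min Q..<Suc (Max Q)}"
    have "i \<le> d * Min Q + r" "d * Max Q + r \<le> j"
      using mm unfolding Q_def by blast+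
    moreover have "d * Min Q \<le> d * q" "d * q \<le> d * Max Q"
      using \<open>q \<in> {Min Q..<Suc (Max Q)}\<close> by auto
    ultimately have "i \<le> d * q + r \<and> d * q + r \<le> j" by linarith
    thus "q \<in> Q" unfolding Q_def by simp
  qed (use fin in \<open>auto simp: less_Suc_eq_le\<close>)
  moreover have "d * (Suc (Max Q) - 1 - Min Q) \<le> j - i"
  proof -
    have "i \<le> d * Min Q + r" "d * Max Q + r \<le> j"
      using mm unfolding Q_def by blast+
    hence "d * Max Q - d * Min Q \<le> j - i" by linarith
    thus ?thesis by (simp add: diff_mult_distrib2)
  qed
  ultimately show ?thesis unfolding Q_def by blast
qed

text \<open>Each step through a residue class advances the phase by d x, so the distance of d x from
  the integers governs the sum. The alternative \<open>S = {}\<close> is present because the bound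
  on the cardinality can be negative when i exceeds j.\<close>

lemma expsum_residue_class:
  fixes d r i j :: nat
  assumes d: "d > 0"
  defines "S \<equiv> {m \<in> {i..j}. [m = r] (mod d)}"
  shows "real (card S) \<le> (real j - real i) / real d + 1 \<or> S = {}"
    and "dist_nearest_int (real d * x) \<noteq> 0 \<Longrightarrow>
           norm (\<Sum>m\<in>S. expi (x * real m)) \<le> 1 / dist_nearest_int (real d * x)"
proof -
  obtain a b where ab: "{q. i \<le> d * q + r mod d \<and> d * q + r mod d \<le> j} = {a..<b}"
      "a < b \<longrightarrow> d * (b - 1 - a) \<le> j - i"
    using nat_interval_preimage[OF d, of i "r mod d" j] by blast
  have S_eq: "S = (\<lambda>q. d * q + r mod d) ` {a..<b}"
  proof -
    have "m \<in> (\<lambda>q. d * q + r mod d) ` {q. i \<le> d * q + r mod d \<and> d * q + r mod d \<le> j}"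
      if "m \<in> S" for m
    proof -
      have "m = d * (m div d) + r mod d"
        using that by (metis (no_types, lifting) S_def cong_def mem_Collect_eq mult_div_mod_eq)
      thus ?thesis using that by (auto simp: S_def intro!: image_eqI[of _ _ "m div d"])
    qed
    moreover have "(\<lambda>q. d * q + r mod d) ` {q. i \<le> d * q + r mod d \<and> d * q + r mod d \<le> j} \<subseteq> S"
      by (auto simp: S_def cong_def)
    ultimately show ?thesis unfolding ab(1)[symmetric] by blast
  qed
  have inj: "inj_on (\<lambda>q. d * q + r mod d) {a..<b}"
    using d by (auto intro!: inj_onI)
  have card: "card S = b - a"
    unfolding S_eq using card_image[OF inj] by simp
  show "real (card S) \<le> (real j - real i) / real d + 1 \<or> S = {}"
  proof (cases "a < b")
    case True
    hence "S \<noteq> {}" by (simp add: S_eq)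
    hence "i \<le> j" by (auto simp: S_def)
    have "real (d * (b - 1 - a)) \<le> real (j - i)" using ab(2) True by (intro of_nat_mono) auto
    also have "real (j - i) = real j - real i" using \<open>i \<le> j\<close> by simp
    also have "real (d * (b - 1 - a)) = real d * (real (b - a) - 1)"
    proof -
      have "b - 1 - a = b - a - 1" by simp
      thus ?thesis using True by (simp add: of_nat_diff)
    qed
    finally have "real (b - a) - 1 \<le> (real j - real i) / real d"
      using d by (simp add: field_simps)
    thus ?thesis using card by simp
  qed (auto simp: S_eq)
  assume nz: "dist_nearest_int (real d * x) \<noteq> 0"
  have "(\<Sum>m\<in>S. expi (x * real m)) = (\<Sum>q = a..<b. expi (x * real (d * q + r mod d)))"
    unfolding S_eq by (simp add: sum.reindex[OF inj])
  also have "\<dots> = expi (x * real (r mod d)) * (\<Sum>q = a..<b. expi (real d * x * real q))"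
    unfolding sum_distrib_left by (intro sum.cong refl) (simp add: cis_mult algebra_simps)
  also have "norm \<dots> = norm (\<Sum>q = a..<b. expi (real d * x * real q))"
    by (simp add: norm_mult)
  also have "\<dots> \<le> 1 / dist_nearest_int (real d * x)"
    by (rule norm_sum_expi_le) fact
  finally show "norm (\<Sum>m\<in>S. expi (x * real m)) \<le> 1 / dist_nearest_int (real d * x)" .
qed

section \<open>Vaughan's identity\<close>

definition moebius_mu :: "nat \<Rightarrow> real" where
  "moebius_mu n = (if squarefree n then (-1) ^ card (prime_factors n) else 0)"

lemma abs_moebius_le_1: "\<bar>moebius_mu n\<bar> \<le> 1"
  by (simp add: moebius_mu_def power_abs)

lemma moebius_prime_mult:
  assumes p: "prime p" and "\<not> p dvd b"
  shows "moebius_mu (p * b) = - moebius_mu b"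
proof -
  have b0: "b > 0" using assms by (intro Nat.gr0I) auto
  have cop: "coprime p b" using assms by (simp add: prime_imp_coprime)
  have sq: "squarefree (p * b) \<longleftrightarrow> squarefree b"
    using squarefree_mult_coprime[OF cop] squarefree_prime[OF p] squarefree_mono[of b "p * b"] by auto
  have "prime_factors (p * b) = insert p (prime_factors b)"
    using p b0 by (subst prime_factors_product) (auto simp: prime_prime_factors)
  moreover have "p \<notin> prime_factors b" using assms by auto
  ultimately have "card (prime_factors (p * b)) = Suc (card (prime_factors b))"
    by simp
  thus ?thesis using sq by (simp add: moebius_mu_def)
qed

text \<open>For one fixed prime p dividing n, each squarefree divisor a prime to p is paired with p
  a, and the two terms cancel.\<close>

lemma sum_moebius_divisors:
  assumes "n > 0"
  shows "(\<Sum>b | b dvd n. moebius_mu b) = (if n = 1 then 1 else 0)"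
proof (cases "n = 1")
  case True
  have "{b::nat. b dvd 1} = {1}" by auto
  with True show ?thesis by (simp add: moebius_mu_def)
next
  case False
  then obtain p where p: "prime p" "p dvd n" using prime_factor_nat by blast
  have fin: "finite {b. b dvd n}" using assms by simp
  define A where "A = {b. b dvd n \<and> \<not> p dvd b \<and> squarefree b}"
  define B where "B = {b. b dvd n \<and> p dvd b \<and> squarefree b}"
  have finA: "finite A" "finite B"
    unfolding A_def B_def by (rule finite_subset[OF _ fin], blast)+
  have B_eq: "B = (*) p ` A"
  proof (intro set_eqI iffI)
    fix b assume b: "b \<in> B"
    then obtain a where a: "b = p * a" by (auto simp: B_def)
    have "\<not> p dvd a"
    proof
      assume "p dvd a"
      hence "p\<^sup>2 dvd b" using a by (auto simp: power2_eq_square)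
      thus False using b p squarefreeD[of b p] by (auto simp: B_def)
    qed
    moreover have "a dvd n" "squarefree a"
      using b a squarefree_mono[of a b] by (auto simp: B_def intro: dvd_mult_right)
    ultimately show "b \<in> (*) p ` A" using a by (auto simp: A_def)
  next
    fix b assume "b \<in> (*) p ` A"
    then obtain a where a: "b = p * a" "a dvd n" "\<not> p dvd a" "squarefree a" by (auto simp: A_def)
    have cop: "coprime p a" using a p by (simp add: prime_imp_coprime)
    have "squarefree (p * a)"
      using squarefree_mult_coprime[OF cop] squarefree_prime[OF p(1)] a by auto
    moreover have "p * a dvd n" using cop a p by (simp add: divides_mult)
    ultimately show "b \<in> B" using a by (simp add: B_def)
  qed
  have "(\<Sum>b | b dvd n. moebius_mu b) = (\<Sum>b\<in>A \<union> B. moebius_mu b)"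
    using fin by (intro sum.mono_neutral_right) (auto simp: A_def B_def moebius_mu_def)
  also have "\<dots> = (\<Sum>b\<in>A. moebius_mu b) + (\<Sum>b\<in>B. moebius_mu b)"
    using finA by (intro sum.union_disjoint) (auto simp: A_def B_def)
  also have "(\<Sum>b\<in>B. moebius_mu b) = (\<Sum>a\<in>A. moebius_mu (p * a))"
    unfolding B_eq using p by (subst sum.reindex) (auto simp: inj_on_def)
  also have "\<dots> = (\<Sum>a\<in>A. - moebius_mu a)"
    using p by (intro sum.cong) (auto simp: A_def moebius_prime_mult)
  finally show ?thesis using False by (simp add: sum_negf)
qed

text \<open>The substitution n = b m. It serves twice: to sum Vaughan's identity over n, and to open
  and close the convolution in the second type I sum.\<close>

lemma sum_divisors_regroup:
  fixes h :: "nat \<Rightarrow> nat \<Rightarrow> 'a :: comm_monoid_add"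
  shows "(\<Sum>n = 1..X. \<Sum>b | b dvd n. h b (n div b)) = (\<Sum>b = 1..X. \<Sum>m = 1..X div b. h b m)"
proof -
  have "(\<Sum>n = 1..X. \<Sum>b | b dvd n. h b (n div b))
      = (\<Sum>(n, b)\<in>(SIGMA n:{1..X}. {b. b dvd n}). h b (n div b))"
    by (subst sum.Sigma) auto
  also have "\<dots> = (\<Sum>(b, m)\<in>(SIGMA b:{1..X}. {1..X div b}). h b m)"
  proof (rule sum.reindex_bij_witness[of _ "\<lambda>(b, m). (b * m, b)" "\<lambda>(n, b). (b, n div b)"])
    fix a assume a: "a \<in> (SIGMA n:{1..X}. {b. b dvd n})"
    then obtain n b where nb: "a = (n, b)" "1 \<le> n" "n \<le> X" "b dvd n" by auto
    hence "b > 0" "b \<le> n" by (auto intro!: Nat.gr0I dvd_imp_le)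
    moreover have "n div b \<le> X div b" using nb by (intro div_le_mono)
    moreover have "n div b \<ge> 1" using nb \<open>b > 0\<close> \<open>b \<le> n\<close>
      by (simp add: Suc_le_eq div_greater_zero_iff)
    ultimately show "(case a of (n, b) \<Rightarrow> (b, n div b)) \<in> (SIGMA b:{1..X}. {1..X div b})"
      using nb by auto
  next
    fix a assume a: "a \<in> (SIGMA b:{1..X}. {1..X div b})"
    then obtain b m where bm: "a = (b, m)" "1 \<le> b" "b \<le> X" "1 \<le> m" "m \<le> X div b" by auto
    have "b * m \<le> X" using bm by (metis mult.commute less_eq_div_iff_mult_less_eq less_le_trans zero_less_one)
    thus "(case a of (b, m) \<Rightarrow> (b * m, b)) \<in> (SIGMA n:{1..X}. {b. b dvd n})"
      using bm by auto
  qed auto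
  also have "\<dots> = (\<Sum>b = 1..X. \<Sum>m = 1..X div b. h b m)"
    by (subst sum.Sigma) auto
  finally show ?thesis .
qed

text \<open>Both nested divisibility conditions say that b c divides n, so the sums can be
  interchanged; the inner Moebius sum then vanishes unless c = n.\<close>

lemma moebius_inversion:
  assumes "n > 0"
  shows "(\<Sum>b | b dvd n. moebius_mu b * (\<Sum>c | c dvd n div b. g c)) = (g n :: real)"
proof -
  have fin: "finite {b. b dvd n}" using assms by simp
  have fin': "finite {c. c dvd n div b}" if "b dvd n" for b
    using assms that by (intro finite_divisors_nat) (auto elim!: dvdE intro!: Nat.gr0I)
  have "(\<Sum>b | b dvd n. moebius_mu b * (\<Sum>c | c dvd n div b. g c))
      = (\<Sum>(b, c)\<in>(SIGMA b:{b. b dvd n}. {c. c dvd n div b}). moebius_mu b * g c)"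
    unfolding sum_distrib_left using fin fin' by (subst sum.Sigma) auto
  also have "\<dots> = (\<Sum>(c, b)\<in>(SIGMA c:{c. c dvd n}. {b. b dvd n div c}). moebius_mu b * g c)"
  proof -
    have swap: "b dvd n \<and> c dvd n div b \<longleftrightarrow> c dvd n \<and> b dvd n div c" for b c
    proof -
      have "b dvd n \<and> c dvd n div b \<longleftrightarrow> b * c dvd n" for b c
        using assms by (cases "b = 0") (auto simp: dvd_div_iff_mult mult.commute intro: dvd_mult_left)
      from this[of b c] this[of c b] show ?thesis by (simp add: mult.commute)
    qed
    show ?thesis
      by (rule sum.reindex_bij_witness[of _ prod.swap prod.swap]) (use swap in auto)
  qed
  also have "\<dots> = (\<Sum>c | c dvd n. g c * (\<Sum>b | b dvd n div c. moebius_mu b))"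
    unfolding sum_distrib_left using fin fin' by (subst sum.Sigma) (auto simp: mult.commute)
  also have "\<dots> = (\<Sum>c | c dvd n. if c = n then g c else 0)"
  proof (rule sum.cong[OF refl])
    fix c assume "c \<in> {c. c dvd n}"
    hence c: "c dvd n" by simp
    hence "n div c > 0" "n div c = 1 \<longleftrightarrow> c = n"
      using assms by (auto elim!: dvdE)
    thus "g c * (\<Sum>b | b dvd n div c. moebius_mu b) = (if c = n then g c else 0)"
      by (subst sum_moebius_divisors) auto
  qed
  also have "\<dots> = g n" using fin by simp
  finally show ?thesis .
qed

text \<open>The Dirichlet convolution of 1 with \<Lambda> truncated at V. Together with its
  counterpart for c > V it splits the identity ln = 1 * \<Lambda>.\<close>

definition mangoldt_small :: "nat \<Rightarrow> nat \<Rightarrow> real" where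
  "mangoldt_small V m = (\<Sum>c | c dvd m. if c \<le> V then mangoldt c else 0)"

definition mangoldt_large :: "nat \<Rightarrow> nat \<Rightarrow> real" where
  "mangoldt_large V m = (\<Sum>c | c dvd m. if c \<le> V then 0 else mangoldt c)"

lemma mangoldt_small_plus_large:
  assumes "m > 0"
  shows "mangoldt_small V m + mangoldt_large V m = ln (real m)"
proof -
  have "mangoldt_small V m + mangoldt_large V m = (\<Sum>c | c dvd m. mangoldt c)"
    unfolding mangoldt_small_def mangoldt_large_def sum.distrib[symmetric]
    by (intro sum.cong) auto
  thus ?thesis using mangoldt_sum[of m, where ?'a = real] assms by simp
qed

lemma mangoldt_small_nonneg: "mangoldt_small V m \<ge> 0"
  and mangoldt_large_nonneg: "mangoldt_large V m \<ge> 0"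
  unfolding mangoldt_small_def mangoldt_large_def
  by (auto intro!: sum_nonneg simp: mangoldt_nonneg)

lemma mangoldt_large_le_ln: "m > 0 \<Longrightarrow> mangoldt_large V m \<le> ln (real m)"
  using mangoldt_small_plus_large[of m V] mangoldt_small_nonneg[of V m] by simp

lemma mangoldt_large_eq_0: "m \<le> V \<Longrightarrow> m > 0 \<Longrightarrow> mangoldt_large V m = 0"
  unfolding mangoldt_large_def by (intro sum.neutral) (auto dest: dvd_imp_le)

text \<open>In convolution notation \<Lambda> = \<mu> * ln. The factor \<mu> is cut at U, and for b
  > U the logarithm is split into its small and large part. Since \<mu> convolved with the small
  part gives back \<Lambda> on n \<le> V, the piece with b > U and small part is traded for one with
  b \<le> U. The second and third terms are of type I; the last one lives on b > U and m > V and is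
  of type II.\<close>

theorem vaughan_identity:
  assumes n: "n > 0"
  shows "mangoldt n = (if n \<le> V then mangoldt n else 0)
           + (\<Sum>b | b dvd n. if b \<le> U then moebius_mu b * ln (real (n div b)) else 0)
           - (\<Sum>b | b dvd n. if b \<le> U then moebius_mu b * mangoldt_small V (n div b) else 0)
           + (\<Sum>b | b dvd n. if b \<le> U then 0 else moebius_mu b * mangoldt_large V (n div b))"
proof -
  have pos: "n div b > 0" if "b dvd n" for b using n that by (auto elim!: dvdE)
  have "mangoldt n = (\<Sum>b | b dvd n. moebius_mu b * (\<Sum>c | c dvd n div b. mangoldt c))"
    using moebius_inversion[OF n, of mangoldt] by simp
  also have "\<dots> = (\<Sum>b | b dvd n. moebius_mu b * ln (real (n div b)))"
    using pos by (intro sum.cong) (auto simp: mangoldt_sum)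
  also have "\<dots> = (\<Sum>b | b dvd n. if b \<le> U then moebius_mu b * ln (real (n div b)) else 0)
      + (\<Sum>b | b dvd n. if b \<le> U then 0 else moebius_mu b * mangoldt_small V (n div b))
      + (\<Sum>b | b dvd n. if b \<le> U then 0 else moebius_mu b * mangoldt_large V (n div b))"
    unfolding sum.distrib[symmetric]
    by (intro sum.cong) (auto simp: mangoldt_small_plus_large[OF pos, symmetric, of _ V] distrib_left)
  also have "(\<Sum>b | b dvd n. if b \<le> U then 0 else moebius_mu b * mangoldt_small V (n div b))
      = (\<Sum>b | b dvd n. moebius_mu b * mangoldt_small V (n div b))
        - (\<Sum>b | b dvd n. if b \<le> U then moebius_mu b * mangoldt_small V (n div b) else 0)"
    unfolding sum_subtractf[symmetric] by (intro sum.cong) auto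
  also have "(\<Sum>b | b dvd n. moebius_mu b * mangoldt_small V (n div b)) = (if n \<le> V then mangoldt n else 0)"
    unfolding mangoldt_small_def by (rule moebius_inversion[OF n])
  finally show ?thesis by simp
qed

section \<open>Sums over well-spaced phases\<close>

text \<open>At most one \<open>q\<close> in the block has \<open>\<parallel>z q + w\<parallel> < \<delta>/2\<close>; the others are bounded by \<open>2/\<delta>\<close>.\<close>
lemma sum_spaced_block_le:
  fixes g :: "nat \<Rightarrow> real"
  assumes \<delta>: "\<delta> > 0" and Y: "Y \<ge> 0"
    and le_Y: "\<And>q. q \<in> {s..<s + L} \<Longrightarrow> g q \<le> Y"
    and far: "\<And>q. q \<in> {s..<s + L} \<Longrightarrow> \<delta> / 2 \<le> dist_nearest_int (z * real q + w) \<Longrightarrow> g q \<le> 2 / \<delta>"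
    and spaced: "\<And>j. 1 \<le> j \<Longrightarrow> j < L \<Longrightarrow> \<delta> \<le> dist_nearest_int (z * real j)"
  shows "(\<Sum>q = s..<s + L. g q) \<le> Y + 2 * real L / \<delta>"
proof -
  define I where "I = {s..<s + L}"
  define B where "B = {q \<in> I. dist_nearest_int (z * real q + w) < \<delta> / 2}"
  have "q = q'" if "q \<in> B" "q' \<in> B" "q \<le> q'" for q q'
  proof (rule ccontr)
    assume "q \<noteq> q'"
    with that have "\<delta> \<le> dist_nearest_int (z * real (q' - q))"
      by (intro spaced) (auto simp: B_def I_def)
    also have "z * real (q' - q) = (z * real q' + w) - (z * real q + w)"
      using that by (simp add: algebra_simps of_nat_diff)
    also have "dist_nearest_int \<dots> \<le> dist_nearest_int (z * real q' + w) + dist_nearest_int (z * real q + w)"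
      by (rule dist_nearest_int_diff)
    also have "\<dots> < \<delta>" using that by (simp add: B_def)
    finally show False by simp
  qed
  hence "\<forall>q\<in>B. \<forall>q'\<in>B. q = q'" by (metis nle_le)
  moreover have "finite B" by (simp add: B_def I_def)
  ultimately have cardB: "card B \<le> 1" using card_le_Suc0_iff_eq[of B] by simp
  have "(\<Sum>q\<in>I. g q) = (\<Sum>q\<in>B. g q) + (\<Sum>q\<in>I - B. g q)"
    by (subst sum.subset_diff[of B I]) (auto simp: B_def I_def)
  also have "(\<Sum>q\<in>B. g q) \<le> real (card B) * Y"
    by (rule sum_bounded_above) (auto simp: B_def I_def le_Y)
  also have "\<dots> \<le> 1 * Y" using cardB Y by (intro mult_right_mono) auto
  also have "(\<Sum>q\<in>I - B. g q) \<le> real (card (I - B)) * (2 / \<delta>)"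
    by (rule sum_bounded_above) (auto simp: B_def I_def not_less far)
  also have "\<dots> \<le> real L * (2 / \<delta>)"
  proof (intro mult_right_mono)
    have "card (I - B) \<le> card I" by (intro card_mono) (auto simp: I_def)
    thus "real (card (I - B)) \<le> real L" by (simp add: I_def)
  qed (use \<delta> in auto)
  finally show ?thesis by (simp add: I_def mult_ac)
qed

lemma sum_spaced_blocks_le:
  fixes g :: "nat \<Rightarrow> real"
  assumes "\<delta> > 0" "Y \<ge> 0" and "\<And>q. g q \<le> Y"
    and "\<And>q. \<delta> / 2 \<le> dist_nearest_int (z * real q + w) \<Longrightarrow> g q \<le> 2 / \<delta>"
    and "\<And>j. 1 \<le> j \<Longrightarrow> j < L \<Longrightarrow> \<delta> \<le> dist_nearest_int (z * real j)"
  shows "(\<Sum>q<n * L. g q) \<le> real n * (Y + 2 * real L / \<delta>)"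
proof -
  have "(\<Sum>q<n * L. g q) = (\<Sum>i<n. \<Sum>q = i * L..<i * L + L. g q)"
    by (rule sum.nat_group[symmetric])
  also have "\<dots> \<le> of_nat (card {..<n}) * (Y + 2 * real L / \<delta>)"
    by (intro sum_bounded_above sum_spaced_block_le) (use assms in auto)
  finally show ?thesis by simp
qed

lemma harm_le_ln: "n > 0 \<Longrightarrow> harm n \<le> 1 + ln (real n)"
  using decseqD[OF decseq_harm_diff_ln, of 0 "n - 1"] by (simp add: harm_expand)

text \<open>The range of t is cut into blocks of length L. On 1 \<le> t < L nothing is resonant,
  because \<open>spaced\<close> applies to t itself. In the j-th later block at most one t is
  resonant, and there the trivial bound is at most Z/(j L) + 1. Summation over j turns this into a
  harmonic sum, so the trivial total is reduced by the factor L.\<close>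

lemma sum_type_I_le:
  fixes G :: "nat \<Rightarrow> real"
  assumes \<delta>: "0 < \<delta>" "\<delta> \<le> 1 / 2" and Z: "Z \<ge> 0" and L: "L > 0" and R: "R > 0"
    and len: "\<And>t. t > 0 \<Longrightarrow> G t \<le> Z / real t + 1" and nonneg: "\<And>t. 0 \<le> G t"
    and far: "\<And>t. dist_nearest_int (y * real t) \<noteq> 0 \<Longrightarrow> G t \<le> 1 / dist_nearest_int (y * real t)"
    and spaced: "\<And>j. 1 \<le> j \<Longrightarrow> j \<le> L \<Longrightarrow> \<delta> \<le> dist_nearest_int (y * real j)"
  shows "(\<Sum>t = 1..R. G t) \<le> Z / real L * (1 + ln (real R)) + (3 * real R + real L) / \<delta>"
proof -
  define J where "J = R div L"
  have far': "G t \<le> 1 / \<epsilon>" if "\<epsilon> \<le> dist_nearest_int (y * real t)" "\<epsilon> > 0" for t \<epsilon>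
  proof -
    have "G t \<le> 1 / dist_nearest_int (y * real t)" using that by (intro far) auto
    also have "\<dots> \<le> 1 / \<epsilon>" using that by (intro divide_left_mono) auto
    finally show ?thesis .
  qed
  have first: "(\<Sum>t = 1..<L. G t) \<le> real L / \<delta>"
  proof -
    have "(\<Sum>t = 1..<L. G t) \<le> real (card {1..<L}) * (1 / \<delta>)"
      by (intro sum_bounded_above far' spaced) (use \<delta> in auto)
    also have "\<dots> \<le> real L * (1 / \<delta>)" using \<delta> by (intro mult_right_mono) auto
    finally show ?thesis by simp
  qed
  have block: "(\<Sum>t = j * L..<j * L + L. G t) \<le> (Z / (real j * real L) + 1) + 2 * real L / \<delta>"
    if j: "j \<ge> 1" for j
  proof (rule sum_spaced_block_le[where z = y and w = 0])
    fix t assume t: "t \<in> {j * L..<j * L + L}"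
    have "0 < j * L" using j L by simp
    also have "j * L \<le> t" using t by simp
    finally have tpos: "t > 0" .
    have "G t \<le> Z / real t + 1" by (rule len) fact
    also have "Z / real t \<le> Z / real (j * L)"
      using t Z j L tpos by (intro divide_left_mono of_nat_mono) auto
    finally show "G t \<le> Z / (real j * real L) + 1" by simp
    show "G t \<le> 2 / \<delta>" if "\<delta> / 2 \<le> dist_nearest_int (y * real t + 0)"
      using far'[of "\<delta> / 2" t] that \<delta> by simp
  qed (use \<delta> Z spaced in auto)
  have "{1..R} \<subseteq> {1..<L} \<union> (\<Union>j\<in>{1..J}. {j * L..<j * L + L})"
  proof
    fix t assume t: "t \<in> {1..R}"
    show "t \<in> {1..<L} \<union> (\<Union>j\<in>{1..J}. {j * L..<j * L + L})"
    proof (cases "t < L")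
      case False
      have "t div L \<in> {1..J}"
        using False t L by (auto simp: J_def Suc_le_eq div_greater_zero_iff intro: div_le_mono)
      moreover have "t \<in> {t div L * L..<t div L * L + L}"
        using L by (metis atLeastLessThan_iff div_mult_mod_eq le_add1 mod_less_divisor nat_add_left_cancel_less)
      ultimately show ?thesis by blast
    qed (use t in auto)
  qed
  hence "(\<Sum>t = 1..R. G t) \<le> (\<Sum>t\<in>{1..<L} \<union> (\<Union>j\<in>{1..J}. {j * L..<j * L + L}). G t)"
    by (intro sum_mono2) (auto simp: nonneg)
  also have "\<dots> \<le> (\<Sum>t = 1..<L. G t) + (\<Sum>t\<in>(\<Union>j\<in>{1..J}. {j * L..<j * L + L}). G t)"
    by (subst sum_Un) (auto intro!: sum_nonneg nonneg)
  also have "(\<Sum>t\<in>(\<Union>j\<in>{1..J}. {j * L..<j * L + L}). G t) = (\<Sum>j = 1..J. \<Sum>t = j * L..<j * L + L. G t)"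
  proof (rule sum.UNION_disjoint)
    show "\<forall>i\<in>{1..J}. \<forall>j\<in>{1..J}. i \<noteq> j \<longrightarrow> {i * L..<i * L + L} \<inter> {j * L..<j * L + L} = {}"
    proof (intro ballI impI equals0I)
      fix i j t assume "i \<noteq> j" and t: "t \<in> {i * L..<i * L + L} \<inter> {j * L..<j * L + L}"
      have "t div L = i" "t div L = j" using t L
        by (auto intro!: div_nat_eqI simp: algebra_simps)
      thus False using \<open>i \<noteq> j\<close> by simp
    qed
  qed auto
  also have "\<dots> \<le> (\<Sum>j = 1..J. (Z / (real j * real L) + 1) + 2 * real L / \<delta>)"
    by (intro sum_mono block) auto
  also have "\<dots> = Z / real L * harm J + real J * (1 + 2 * real L / \<delta>)"
    by (simp add: sum.distrib harm_def sum_distrib_left field_simps)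
  also have "Z / real L * harm J \<le> Z / real L * (1 + ln (real R))"
  proof (cases "J = 0")
    case True
    thus ?thesis using Z R by (simp add: harm_expand)
  next
    case False
    have "harm J \<le> 1 + ln (real J)" using False by (intro harm_le_ln) auto
    also have "\<dots> \<le> 1 + ln (real R)" using False R by (simp add: J_def)
    finally show ?thesis using Z by (intro mult_left_mono) auto
  qed
  also have "real J * (1 + 2 * real L / \<delta>) \<le> 3 * real R / \<delta>"
  proof -
    have "real J * real L \<le> real R"
      unfolding J_def by (metis div_times_less_eq_dividend of_nat_le_iff of_nat_mult)
    \<comment> \<open>The summand 1 of each block is absorbed into L/\<delta>, which produces the
      constant 3.\<close>
    have "1 \<le> real L / \<delta>" using \<delta> L by (simp add: field_simps)
    hence "real J * (1 + 2 * real L / \<delta>) \<le> real J * (3 * (real L / \<delta>))"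
      by (intro mult_left_mono) auto
    also have "\<dots> = 3 * (real J * real L) / \<delta>" by simp
    also have "\<dots> \<le> 3 * real R / \<delta>"
      using \<open>real J * real L \<le> real R\<close> \<delta> by (intro divide_right_mono) auto
    finally show ?thesis .
  qed
  finally show ?thesis using first by (simp add: add_divide_distrib)
qed

text \<open>One solution r already makes m invertible modulo d, because r m is congruent to c and c
  is prime to d; then m can be cancelled.\<close>

lemma residue_condition_eq:
  fixes c d m :: nat
  assumes "coprime c d"
  shows "{a \<in> {i..j}. [a * m = c] (mod d)} = {} \<or>
         (\<exists>r. {a \<in> {i..j}. [a * m = c] (mod d)} = {a \<in> {i..j}. [a = r] (mod d)})"
proof (cases "{a \<in> {i..j}. [a * m = c] (mod d)} = {}")
  case False
  then obtain r where r: "[r * m = c] (mod d)" by auto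
  have "coprime (r * m) d" using r assms by (metis cong_imp_coprime cong_sym)
  hence cop: "coprime m d" by simp
  have "[a * m = c] (mod d) \<longleftrightarrow> [a = r] (mod d)" for a
  proof
    assume "[a * m = c] (mod d)"
    hence "[a * m = r * m] (mod d)" using r by (metis cong_sym cong_trans)
    thus "[a = r] (mod d)" using cop cong_mult_rcancel_nat by blast
  next
    assume "[a = r] (mod d)"
    hence "[a * m = r * m] (mod d)" by (rule cong_scalar_right)
    thus "[a * m = c] (mod d)" using r by (rule cong_trans)
  qed
  thus ?thesis by blast
qed auto

text \<open>The \<open>max 0\<close> covers an empty interval, where the counting formula can be
  negative.\<close>

lemma expsum_congruence:
  fixes c d m i j :: nat and u :: real
  assumes "coprime c d" "d > 0"
  defines "T \<equiv> (\<Sum>a = i..j. if [a * m = c] (mod d) then expi (u * real a) else 0)"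
  shows "norm T \<le> max 0 ((real j - real i) / real d + 1)"
    and "dist_nearest_int (real d * u) \<noteq> 0 \<Longrightarrow> norm T \<le> 1 / dist_nearest_int (real d * u)"
proof -
  define S where "S = {a \<in> {i..j}. [a * m = c] (mod d)}"
  have T: "T = (\<Sum>a\<in>S. expi (u * real a))"
    unfolding T_def S_def by (rule sum.inter_filter[symmetric]) simp
  have S: "S = {} \<or> (\<exists>r. S = {a \<in> {i..j}. [a = r] (mod d)})"
    unfolding S_def using assms by (intro residue_condition_eq)
  have "norm T \<le> (\<Sum>a\<in>S. norm (expi (u * real a)))" unfolding T by (rule norm_sum)
  hence "norm T \<le> real (card S)" by simp
  moreover have "real (card S) \<le> max 0 ((real j - real i) / real d + 1)"
    using S
  proof
    assume "\<exists>r. S = {a \<in> {i..j}. [a = r] (mod d)}"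
    then obtain r where r: "S = {a \<in> {i..j}. [a = r] (mod d)}" ..
    have "real (card S) \<le> (real j - real i) / real d + 1 \<or> S = {}"
      unfolding r by (rule expsum_residue_class(1)[OF assms(2)])
    thus ?thesis by auto
  qed auto
  ultimately show "norm T \<le> max 0 ((real j - real i) / real d + 1)" by linarith
  assume nz: "dist_nearest_int (real d * u) \<noteq> 0"
  show "norm T \<le> 1 / dist_nearest_int (real d * u)"
    using S
  proof
    assume "S = {}"
    thus ?thesis by (simp add: T dist_nearest_int_nonneg)
  next
    assume "\<exists>r. S = {a \<in> {i..j}. [a = r] (mod d)}"
    then obtain r where r: "S = {a \<in> {i..j}. [a = r] (mod d)}" ..
    show ?thesis unfolding T r by (rule expsum_residue_class(2)[OF assms(2) nz])
  qed
qed

section \<open>The bilinear form over a progression\<close>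

definition prog_expi :: "nat \<Rightarrow> nat \<Rightarrow> real \<Rightarrow> nat \<Rightarrow> complex" where
  "prog_expi d c x n = (if [n = c] (mod d) then expi (x * real n) else 0)"

lemma norm_prog_expi_le_1: "norm (prog_expi d c x n) \<le> 1"
  by (simp add: prog_expi_def)

text \<open>This decoupling keeps the bilinear argument inside the progression. If a m and a m' are
  both congruent to the unit c, then a is a unit and cancels, so m' and m agree modulo d;
  conversely, given that agreement, a single congruence for a remains.\<close>

lemma prog_expi_mult_cnj:
  assumes "coprime c d"
  shows "prog_expi d c x (a * m) * cnj (prog_expi d c x (a * m')) =
    (if [m' = m] (mod d) then if [a * m = c] (mod d) then expi (x * (real m - real m') * real a) else 0 else 0)"
proof -
  have *: "[m' = m] (mod d)" if "[a * m = c] (mod d)" "[a * m' = c] (mod d)"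
  proof -
    have "coprime (a * m) d" using cong_imp_coprime[OF cong_sym[OF that(1)] assms] .
    hence "coprime a d" by simp
    moreover have "[a * m' = a * m] (mod d)" using cong_trans[OF that(2) cong_sym[OF that(1)]] .
    ultimately show ?thesis using cong_mult_lcancel_nat by blast
  qed
  have **: "[a * m' = c] (mod d)" if "[m' = m] (mod d)" "[a * m = c] (mod d)"
    using cong_trans[OF cong_scalar_left[OF that(1)] that(2)] .
  have "expi (x * real (a * m)) * cnj (expi (x * real (a * m'))) = expi (x * (real m - real m') * real a)"
    by (simp add: cis_cnj cis_mult algebra_simps)
  thus ?thesis
    using * ** unfolding prog_expi_def
    by (cases "[m' = m] (mod d)"; cases "[a * m = c] (mod d)"; cases "[a * m' = c] (mod d)") simp_all
qed

text \<open>After Cauchy-Schwarz over a, the square is opened so that \<open>f\<close> enters only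
  through its bound and the sum over a is innermost. That sum runs over one residue class, has at
  most A/d + 1 terms, and its phase advances by d x (m - m'). As m - m' is a multiple of d, the
  phases to be spaced are multiples of d^2 x, and these are treated in blocks of L.\<close>

lemma bilinear_block_le:
  fixes f :: "nat \<Rightarrow> real"
  assumes cop: "coprime c d" and d: "d > 0" and \<delta>: "\<delta> > 0" and L: "L > 0" and A: "A > 0"
    and f: "\<And>m. 1 \<le> m \<Longrightarrow> m \<le> X \<Longrightarrow> \<bar>f m\<bar> \<le> lam"
    and lam: "lam \<ge> 0"
    and spaced: "\<And>j. 1 \<le> j \<Longrightarrow> j \<le> L \<Longrightarrow> \<delta> \<le> dist_nearest_int (real d * (real d * x) * real j)"
  shows "(\<Sum>a = A + 1..2 * A. norm (\<Sum>m = 1..X div a. of_real (f m) * prog_expi d c x (a * m)))\<^sup>2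
    \<le> lam\<^sup>2 * real X * (real X / (real A * real d * real L) + 1) * (real A / real d + 1 + 2 * real L / \<delta>)"
proof -
  define F where "F = prog_expi d c x"
  define M where "M = X div A"
  define Zs where "Zs = (\<lambda>a. \<Sum>m = 1..X div a. of_real (f m) * F (a * m))"
  define h where "h = (\<lambda>a m. if m \<le> X div a then of_real (f m) * F (a * m) else 0)"
  \<comment> \<open>For fixed m and m' the conditions a m \<le> X and a m' \<le> X cut out an
    interval of a, so the hyperbolic boundary costs nothing.\<close>
  define B where "B = (\<lambda>m m'. min (2 * A) (min (X div m) (X div m')))"
  define g where "g = (\<lambda>m m'. norm (\<Sum>a = A + 1..B m m'. F (a * m) * cnj (F (a * m'))))"
  define Y where "Y = real A / real d + 1"
  \<comment> \<open>The number of blocks of length L that cover all q \<le> M div d.\<close>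
  define n where "n = M div d div L + 1"
  have Z_eq: "Zs a = (\<Sum>m = 1..M. h a m)" if "a \<in> {A + 1..2 * A}" for a
  proof -
    have "X div a \<le> M" unfolding M_def using that A by (intro div_le_mono2) auto
    hence "(\<Sum>m = 1..M. h a m) = (\<Sum>m = 1..X div a. h a m)"
      by (intro sum.mono_neutral_right) (auto simp: h_def)
    thus ?thesis by (simp add: Zs_def h_def)
  qed
  have CS: "(\<Sum>a = A + 1..2 * A. norm (Zs a))\<^sup>2 \<le> real A * (\<Sum>a = A + 1..2 * A. (norm (Zs a))\<^sup>2)"
    using Cauchy_Schwarz_ineq_sum[of "\<lambda>_. 1" "\<lambda>a. norm (Zs a)" "{A + 1..2 * A}"] by simp
  have inner: "(\<Sum>a = A + 1..2 * A. h a m * cnj (h a m'))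
       = of_real (f m * f m') * (\<Sum>a = A + 1..B m m'. F (a * m) * cnj (F (a * m')))"
    if m: "m \<ge> 1" "m' \<ge> 1" for m m'
  proof -
    have le: "m \<le> X div a \<longleftrightarrow> a \<le> X div m" if "a > 0" "m > 0" for a m :: nat
      using that by (simp add: less_eq_div_iff_mult_less_eq mult.commute)
    have "(\<Sum>a = A + 1..2 * A. h a m * cnj (h a m'))
        = (\<Sum>a = A + 1..2 * A. if a \<le> X div m \<and> a \<le> X div m'
             then of_real (f m * f m') * (F (a * m) * cnj (F (a * m'))) else 0)"
      using m by (intro sum.cong refl) (auto simp: h_def le)
    also have "\<dots> = (\<Sum>a = A + 1..B m m'. of_real (f m * f m') * (F (a * m) * cnj (F (a * m'))))"
      by (subst sum.inter_filter[symmetric]) (auto intro!: sum.cong simp: B_def)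
    finally show ?thesis by (simp add: sum_distrib_left)
  qed
  have "complex_of_real (\<Sum>a = A + 1..2 * A. (norm (Zs a))\<^sup>2) = (\<Sum>a = A + 1..2 * A. Zs a * cnj (Zs a))"
    unfolding of_real_sum complex_norm_square ..
  also have "\<dots> = (\<Sum>a = A + 1..2 * A. \<Sum>m = 1..M. \<Sum>m' = 1..M. h a m * cnj (h a m'))"
    by (intro sum.cong refl) (simp add: Z_eq sum_product)
  also have "\<dots> = (\<Sum>m = 1..M. \<Sum>m' = 1..M. \<Sum>a = A + 1..2 * A. h a m * cnj (h a m'))"
    by (rule trans[OF sum.swap], rule sum.cong[OF refl], rule sum.swap)
  also have "\<dots> = (\<Sum>m = 1..M. \<Sum>m' = 1..M. of_real (f m * f m') *
       (\<Sum>a = A + 1..B m m'. F (a * m) * cnj (F (a * m'))))"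
    by (intro sum.cong refl inner) auto
  finally have eq: "complex_of_real (\<Sum>a = A + 1..2 * A. (norm (Zs a))\<^sup>2) = \<dots>" .
  have "(\<Sum>a = A + 1..2 * A. (norm (Zs a))\<^sup>2) = norm (complex_of_real (\<Sum>a = A + 1..2 * A. (norm (Zs a))\<^sup>2))"
    unfolding norm_of_real by (simp add: sum_nonneg)
  also have "\<dots> \<le> (\<Sum>m = 1..M. \<Sum>m' = 1..M. \<bar>f m * f m'\<bar> * g m m')"
    unfolding eq g_def
    by (intro sum_norm_le) (simp add: norm_mult abs_mult)
  also have "\<dots> \<le> (\<Sum>m = 1..M. \<Sum>m' = 1..M. lam\<^sup>2 * g m m')"
  proof (intro sum_mono mult_right_mono)
    fix m m' assume "m \<in> {1..M}" "m' \<in> {1..M}"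
    moreover have "M \<le> X" by (simp add: M_def)
    ultimately show "\<bar>f m * f m'\<bar> \<le> lam\<^sup>2"
      unfolding abs_mult power2_eq_square by (intro mult_mono f) (auto simp: lam)
  qed (simp add: g_def)
  also have "\<dots> = lam\<^sup>2 * (\<Sum>m = 1..M. \<Sum>m' = 1..M. g m m')"
    by (simp add: sum_distrib_left)
  also have "(\<Sum>m = 1..M. \<Sum>m' = 1..M. g m m') \<le> (\<Sum>m = 1..M. real n * (Y + 2 * real L / \<delta>))"
  proof (rule sum_mono)
    fix m assume "m \<in> {1..M}"
    define r where "r = m mod d"
    define q0 where "q0 = m div d"
    have m_eq: "real m = real d * real q0 + real r"
      unfolding r_def q0_def by (metis mult_div_mod_eq of_nat_add of_nat_mult)
    have g0: "g m m' = 0" if "\<not> [m' = m] (mod d)" for m'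
      using that by (simp add: g_def F_def prog_expi_mult_cnj[OF cop])
    have g_eq: "g m m' = norm (\<Sum>a = A + 1..B m m'. if [a * m = c] (mod d) then expi (x * (real m - real m') * real a) else 0)"
      if "[m' = m] (mod d)" for m'
      unfolding g_def F_def prog_expi_mult_cnj[OF cop] using that by simp
    have g_le_Y: "g m m' \<le> Y" for m'
    proof (cases "[m' = m] (mod d)")
      case True
      have "real (B m m') - real (A + 1) \<le> real A" by (simp add: B_def)
      hence "(real (B m m') - real (A + 1)) / real d \<le> real A / real d"
        by (intro divide_right_mono) auto
      moreover have "0 \<le> real A / real d" by simp
      ultimately have "max 0 ((real (B m m') - real (A + 1)) / real d + 1) \<le> Y"
        unfolding Y_def by linarith
      thus ?thesis unfolding g_eq[OF True] by (intro order_trans[OF expsum_congruence(1)[OF cop d]])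
    qed (simp add: g0 Y_def)
    have g_far: "g m (d * q + r) \<le> 2 / \<delta>"
      if "\<delta> / 2 \<le> dist_nearest_int (- (real d * (real d * x)) * real q + real d * (real d * x) * real q0)" for q
    proof (cases "[d * q + r = m] (mod d)")
      case True
      have arg: "real d * (x * (real m - real (d * q + r)))
          = - (real d * (real d * x)) * real q + real d * (real d * x) * real q0"
        unfolding m_eq by (simp add: algebra_simps)
      have ne: "dist_nearest_int (real d * (x * (real m - real (d * q + r)))) \<noteq> 0"
        using that \<delta> unfolding arg by linarith
      have "g m (d * q + r) \<le> 1 / dist_nearest_int (real d * (x * (real m - real (d * q + r))))"
        unfolding g_eq[OF True] by (rule expsum_congruence(2)[OF cop d ne])
      also have "\<dots> \<le> 1 / (\<delta> / 2)"
        unfolding arg using that \<delta> by (intro divide_left_mono mult_pos_pos) auto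
      finally show ?thesis by simp
    qed (use \<delta> in \<open>simp add: g0\<close>)
    have "(\<Sum>m' = 1..M. g m m') = (\<Sum>m' \<in> {m' \<in> {1..M}. [m' = m] (mod d)}. g m m')"
      by (intro sum.mono_neutral_right) (auto simp: g0)
    \<comment> \<open>Completing the last block only adds nonnegative terms.\<close>
    also have "\<dots> \<le> (\<Sum>m' \<in> (\<lambda>q. d * q + r) ` {..<n * L}. g m m')"
    proof (rule sum_mono2)
      show "{m' \<in> {1..M}. [m' = m] (mod d)} \<subseteq> (\<lambda>q. d * q + r) ` {..<n * L}"
      proof
        fix m' assume m': "m' \<in> {m' \<in> {1..M}. [m' = m] (mod d)}"
        hence "m' = d * (m' div d) + r" unfolding r_def by (simp add: cong_def) (metis mult_div_mod_eq)
        moreover have "m' div d < n * L"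
        proof -
          have "m' div d \<le> M div d" using m' by (intro div_le_mono) auto
          also have "M div d < (M div d div L + 1) * L"
            using L by (metis add.commute div_less_iff_less_mult lessI plus_1_eq_Suc)
          finally show ?thesis by (simp add: n_def)
        qed
        ultimately show "m' \<in> (\<lambda>q. d * q + r) ` {..<n * L}" by blast
      qed
    qed (auto simp: g_def)
    also have "\<dots> = (\<Sum>q<n * L. g m (d * q + r))"
      using d by (subst sum.reindex) (auto intro!: inj_onI)
    also have "\<dots> \<le> real n * (Y + 2 * real L / \<delta>)"
    proof (rule sum_spaced_blocks_le[OF \<delta>])
      show "\<delta> \<le> dist_nearest_int (- (real d * (real d * x)) * real j)" if "1 \<le> j" "j < L" for j
        using spaced[of j] that by simp
    qed (use g_le_Y g_far in \<open>auto simp: Y_def\<close>)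
    finally show "(\<Sum>m' = 1..M. g m m') \<le> real n * (Y + 2 * real L / \<delta>)" .
  qed
  also have "\<dots> = real M * (real n * (Y + 2 * real L / \<delta>))" by simp
  finally have sq: "(\<Sum>a = A + 1..2 * A. (norm (Zs a))\<^sup>2) \<le> lam\<^sup>2 * (real M * (real n * (Y + 2 * real L / \<delta>)))"
    by (simp add: mult_left_mono)
  have nonneg: "Y + 2 * real L / \<delta> \<ge> 0" using \<delta> by (simp add: Y_def)
  have n_le: "real n \<le> real X / (real A * real d * real L) + 1"
  proof -
    have "M div d div L = X div (A * d * L)" by (simp add: M_def div_mult2_eq)
    thus ?thesis using of_nat_div_le_of_nat[of X "A * d * L"] by (simp add: n_def)
  qed
  have "(\<Sum>a = A + 1..2 * A. norm (Zs a))\<^sup>2 \<le> real A * (lam\<^sup>2 * (real M * (real n * (Y + 2 * real L / \<delta>))))"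
    using CS sq by (meson mult_left_mono of_nat_0_le_iff order_trans)
  \<comment> \<open>The factor A from Cauchy-Schwarz meets the M values of m, and A M \<le>
    X.\<close>
  also have "\<dots> = lam\<^sup>2 * (real A * real M) * real n * (Y + 2 * real L / \<delta>)" by simp
  also have "\<dots> \<le> lam\<^sup>2 * real X * (real X / (real A * real d * real L) + 1) * (Y + 2 * real L / \<delta>)"
  proof (intro mult_right_mono mult_mono mult_left_mono n_le nonneg)
    show "real A * real M \<le> real X"
      unfolding M_def by (metis of_nat_mult of_nat_le_iff times_div_less_eq_dividend)
  qed auto
  finally show ?thesis by (simp add: Zs_def F_def Y_def)
qed

section \<open>Primes in arithmetic progressions\<close>

lemma norm_sum_monotone_weights_le:
  fixes w :: "nat \<Rightarrow> real" and z :: "nat \<Rightarrow> complex"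
  assumes "w 0 = 0" and "mono w" and tails: "\<And>j. 1 \<le> j \<Longrightarrow> norm (\<Sum>m = j..Y. z m) \<le> B"
  shows "norm (\<Sum>m = 1..Y. of_real (w m) * z m) \<le> w Y * B"
proof -
  \<comment> \<open>The weight w m is the sum of these nonnegative increments up to m. Interchanging
    the sums leaves tails of \<open>z\<close>, and the increments add up to w Y, so no factor 2
    arises.\<close>
  define v where "v = (\<lambda>j. w j - w (j - 1))"
  have v0: "v j \<ge> 0" for j using monoD[OF assms(2), of "j - 1" j] by (simp add: v_def)
  have tel: "(\<Sum>j = 1..m. v j) = w m" for m
    using assms(1) by (induction m) (auto simp: v_def)
  have "(\<Sum>m = 1..Y. of_real (w m) * z m) = (\<Sum>m = 1..Y. \<Sum>j = 1..Y. if j \<le> m then of_real (v j) * z m else 0)"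
  proof (rule sum.cong[OF refl])
    fix m assume m: "m \<in> {1..Y}"
    have "(\<Sum>j = 1..Y. if j \<le> m then of_real (v j) * z m else 0) = (\<Sum>j = 1..m. of_real (v j) * z m)"
      using m by (intro sum.mono_neutral_cong_right) auto
    also have "\<dots> = of_real (w m) * z m"
      unfolding tel[of m, symmetric] by (simp add: sum_distrib_right)
    finally show "of_real (w m) * z m = (\<Sum>j = 1..Y. if j \<le> m then of_real (v j) * z m else 0)" ..
  qed
  also have "\<dots> = (\<Sum>j = 1..Y. \<Sum>m = 1..Y. if j \<le> m then of_real (v j) * z m else 0)"
    by (rule sum.swap)
  also have "\<dots> = (\<Sum>j = 1..Y. of_real (v j) * (\<Sum>m = j..Y. z m))"
    unfolding sum_distrib_left by (intro sum.cong refl sum.mono_neutral_cong_right) auto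
  also have "norm \<dots> \<le> (\<Sum>j = 1..Y. v j * B)"
    using v0 by (intro sum_norm_le) (auto simp: norm_mult intro!: mult_left_mono tails)
  also have "\<dots> = w Y * B" unfolding sum_distrib_right[symmetric] tel ..
  finally show ?thesis .
qed

text \<open>The convention \<open>ln 0 = 0\<close> makes this true from 0 on; it also provides the
  hypothesis \<open>w 0 = 0\<close> of partial summation.\<close>

lemma mono_ln_nat: "mono (\<lambda>m::nat. ln (real m))"
proof
  fix m n :: nat assume "m \<le> n"
  thus "ln (real m) \<le> ln (real n)"
    by (cases "m = 0"; cases "n = 0") auto
qed

text \<open>The case distinction is needed because \<open>1 / 0 = 0\<close>.\<close>
definition type_I_bound :: "nat \<Rightarrow> real \<Rightarrow> nat \<Rightarrow> nat \<Rightarrow> real" where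
  "type_I_bound d y X t =
     (if dist_nearest_int (y * real t) = 0 then real X / real d / real t + 1
      else min (real X / real d / real t + 1) (1 / dist_nearest_int (y * real t)))"

lemma type_I_bound_nonneg: "0 \<le> type_I_bound d y X t"
  by (simp add: type_I_bound_def dist_nearest_int_nonneg)

text \<open>The lower end i is free because partial summation feeds in tails.\<close>

lemma type_I_bound_correct:
  assumes "coprime c d" "d > 0" "t > 0" "i \<ge> 1"
  shows "norm (\<Sum>m = i..X div t. prog_expi d c x (t * m)) \<le> type_I_bound d (real d * x) X t"
proof -
  have eq: "(\<Sum>m = i..X div t. prog_expi d c x (t * m)) =
     (\<Sum>a = i..X div t. if [a * t = c] (mod d) then expi ((x * real t) * real a) else 0)"
    by (intro sum.cong refl) (simp add: prog_expi_def mult_ac)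
  have "real (X div t) - real i \<le> real X / real t"
    using of_nat_div_le_of_nat[of X t, where ?'a = real] by linarith
  hence "(real (X div t) - real i) / real d + 1 \<le> (real X / real t) / real d + 1"
    by (intro add_right_mono divide_right_mono) auto
  hence "max 0 ((real (X div t) - real i) / real d + 1) \<le> real X / real d / real t + 1"
    by (simp add: divide_divide_eq_left mult.commute)
  moreover note len = expsum_congruence(1)[OF assms(1,2), where i = i and j = "X div t" and m = t and u = "x * real t"]
  ultimately have "norm (\<Sum>m = i..X div t. prog_expi d c x (t * m)) \<le> real X / real d / real t + 1"
    unfolding eq by (rule order_trans[rotated])
  thus ?thesis
    using expsum_congruence(2)[OF assms(1,2), where i = i and j = "X div t" and m = t and u = "x * real t"]
    unfolding type_I_bound_def eq by (auto simp: mult.assoc)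
qed

text \<open>The weight ln m is increasing, so partial summation removes it at the price of one
  logarithm. Summing up to R rather than U lets both type I sums share one estimate.\<close>

lemma type_I_ln_sum_le:
  assumes "coprime c d" "d > 0" "X > 0" "U \<le> R"
  shows "norm (\<Sum>b = 1..X. \<Sum>m = 1..X div b. of_real (if b \<le> U then moebius_mu b * ln (real m) else 0) * prog_expi d c x (b * m))
     \<le> ln (real X) * (\<Sum>t = 1..R. type_I_bound d (real d * x) X t)"
proof -
  let ?G = "type_I_bound d (real d * x) X" and ?F = "prog_expi d c x"
  have lnX: "ln (real X) \<ge> 0" using assms(3) by (intro ln_ge_zero) auto
  have "norm (\<Sum>b = 1..X. \<Sum>m = 1..X div b. of_real (if b \<le> U then moebius_mu b * ln (real m) else 0) * ?F (b * m))
      \<le> (\<Sum>b = 1..X. if b \<le> U then ln (real X) * ?G b else 0)"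
  proof (rule sum_norm_le)
    fix b assume b: "b \<in> {1..X}"
    show "norm (\<Sum>m = 1..X div b. of_real (if b \<le> U then moebius_mu b * ln (real m) else 0) * ?F (b * m))
      \<le> (if b \<le> U then ln (real X) * ?G b else 0)"
    proof (cases "b \<le> U")
      case True
      have "(\<Sum>m = 1..X div b. of_real (if b \<le> U then moebius_mu b * ln (real m) else 0) * ?F (b * m))
          = of_real (moebius_mu b) * (\<Sum>m = 1..X div b. of_real (ln (real m)) * ?F (b * m))"
        using True by (simp add: sum_distrib_left mult_ac)
      also have "norm \<dots> \<le> 1 * norm (\<Sum>m = 1..X div b. of_real (ln (real m)) * ?F (b * m))"
        unfolding norm_mult using abs_moebius_le_1[of b] by (intro mult_right_mono) auto
      also have "\<dots> \<le> 1 * (ln (real (X div b)) * ?G b)"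
        by (intro mult_left_mono norm_sum_monotone_weights_le mono_ln_nat type_I_bound_correct)
           (use assms b in auto)
      also have "\<dots> \<le> ln (real X) * ?G b"
        using monoD[OF mono_ln_nat, of "X div b" X] by (auto intro!: mult_right_mono type_I_bound_nonneg)
      finally show ?thesis using True by simp
    qed auto
  qed
  also have "\<dots> = (\<Sum>b \<in> {b \<in> {1..X}. b \<le> U}. ln (real X) * ?G b)"
    by (rule sum.inter_filter[symmetric]) simp
  also have "\<dots> \<le> (\<Sum>b = 1..R. ln (real X) * ?G b)"
    using assms lnX by (intro sum_mono2) (auto simp: type_I_bound_nonneg)
  finally show ?thesis by (simp add: sum_distrib_left)
qed

text \<open>With m = k l and t = k b, the weight collected by t is at most the sum of \<Lambda>(k)
  over all divisors k of t, which is ln t. The coefficients of the combined variable t \<le> U V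
  therefore cost only a logarithm, just as in the smooth type I sum.\<close>

lemma type_I_mangoldt_sum_le:
  assumes cop: "coprime c d" "d > 0" and X: "X > 0" and R: "R = U * V" "R \<le> X"
  shows "norm (\<Sum>b = 1..X. \<Sum>m = 1..X div b. of_real (if b \<le> U then moebius_mu b * mangoldt_small V m else 0) * prog_expi d c x (b * m))
     \<le> ln (real X) * (\<Sum>t = 1..R. type_I_bound d (real d * x) X t)"
proof -
  let ?G = "type_I_bound d (real d * x) X" and ?F = "prog_expi d c x"
  have lnX: "ln (real X) \<ge> 0" using X by (intro ln_ge_zero) auto
  have inner: "norm (\<Sum>m = 1..X div b. of_real (mangoldt_small V m) * ?F (b * m)) \<le> (\<Sum>k = 1..V. mangoldt k * ?G (k * b))"
    if b: "b > 0" for b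
  proof -
    define Y where "Y = X div b"
    have "(\<Sum>m = 1..Y. of_real (mangoldt_small V m) * ?F (b * m)) =
        (\<Sum>m = 1..Y. \<Sum>k | k dvd m. (if k \<le> V then of_real (mangoldt k) else 0) * ?F (b * (k * (m div k))))"
      unfolding mangoldt_small_def of_real_sum sum_distrib_right
      by (intro sum.cong refl) (auto simp del: of_real_mangoldt)
    also have "\<dots> = (\<Sum>k = 1..Y. \<Sum>l = 1..Y div k. (if k \<le> V then of_real (mangoldt k) else 0) * ?F (b * (k * l)))"
      by (rule sum_divisors_regroup)
    also have "norm \<dots> \<le> (\<Sum>k = 1..Y. if k \<le> V then mangoldt k * ?G (k * b) else 0)"
    proof (rule sum_norm_le)
      fix k assume k: "k \<in> {1..Y}"
      show "norm (\<Sum>l = 1..Y div k. (if k \<le> V then of_real (mangoldt k) else 0) * ?F (b * (k * l)))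
         \<le> (if k \<le> V then mangoldt k * ?G (k * b) else 0)"
      proof (cases "k \<le> V")
        case True
        have "(\<Sum>l = 1..Y div k. (if k \<le> V then of_real (mangoldt k) else 0) * ?F (b * (k * l)))
            = mangoldt k * (\<Sum>l = 1..X div (k * b). ?F ((k * b) * l))"
          using True unfolding sum_distrib_left Y_def
          by (intro sum.cong) (auto simp: div_mult2_eq[symmetric] mult_ac)
        also have "norm \<dots> \<le> mangoldt k * ?G (k * b)"
          unfolding norm_mult norm_mangoldt using k b
          by (intro mult_left_mono type_I_bound_correct cop mangoldt_nonneg) auto
        finally show ?thesis using True by simp
      qed auto
    qed
    also have "\<dots> = (\<Sum>k \<in> {k \<in> {1..Y}. k \<le> V}. mangoldt k * ?G (k * b))"
      by (rule sum.inter_filter[symmetric]) simp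
    also have "\<dots> \<le> (\<Sum>k = 1..V. mangoldt k * ?G (k * b))"
      by (intro sum_mono2) (auto intro!: mult_nonneg_nonneg simp: type_I_bound_nonneg mangoldt_nonneg)
    finally show ?thesis by (simp add: Y_def)
  qed
  have "norm (\<Sum>b = 1..X. \<Sum>m = 1..X div b. of_real (if b \<le> U then moebius_mu b * mangoldt_small V m else 0) * ?F (b * m))
      \<le> (\<Sum>b = 1..X. if b \<le> U then \<Sum>k = 1..V. mangoldt k * ?G (k * b) else 0)"
  proof (rule sum_norm_le)
    fix b assume b: "b \<in> {1..X}"
    show "norm (\<Sum>m = 1..X div b. of_real (if b \<le> U then moebius_mu b * mangoldt_small V m else 0) * ?F (b * m))
      \<le> (if b \<le> U then \<Sum>k = 1..V. mangoldt k * ?G (k * b) else 0)"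
    proof (cases "b \<le> U")
      case True
      have "(\<Sum>m = 1..X div b. of_real (if b \<le> U then moebius_mu b * mangoldt_small V m else 0) * ?F (b * m))
          = of_real (moebius_mu b) * (\<Sum>m = 1..X div b. of_real (mangoldt_small V m) * ?F (b * m))"
        using True by (simp add: sum_distrib_left mult_ac)
      also have "norm \<dots> \<le> 1 * norm (\<Sum>m = 1..X div b. of_real (mangoldt_small V m) * ?F (b * m))"
        unfolding norm_mult using abs_moebius_le_1[of b] by (intro mult_right_mono) auto
      finally show ?thesis using True inner[of b] b by simp
    qed auto
  qed
  also have "\<dots> = (\<Sum>b \<in> {b \<in> {1..X}. b \<le> U}. \<Sum>k = 1..V. mangoldt k * ?G (k * b))"
    by (rule sum.inter_filter[symmetric]) simp
  also have "\<dots> \<le> (\<Sum>b = 1..U. \<Sum>k = 1..V. mangoldt k * ?G (k * b))"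
    by (intro sum_mono2) (auto intro!: sum_nonneg mult_nonneg_nonneg simp: type_I_bound_nonneg mangoldt_nonneg)
  also have "\<dots> = (\<Sum>k = 1..V. \<Sum>b = 1..U. mangoldt k * ?G (k * b))"
    by (rule sum.swap)
  \<comment> \<open>Enlarging the rectangle to the region k b \<le> R prepares the regrouping by t =
    k b.\<close>
  also have "\<dots> \<le> (\<Sum>k = 1..V. \<Sum>b = 1..R div k. mangoldt k * ?G (k * b))"
  proof (intro sum_mono sum_mono2)
    fix k assume k: "k \<in> {1..V}"
    have "U \<le> R div k"
      using k unfolding R(1) by (simp add: less_eq_div_iff_mult_less_eq)
    thus "{1..U} \<subseteq> {1..R div k}" by auto
  qed (auto intro!: mult_nonneg_nonneg simp: type_I_bound_nonneg mangoldt_nonneg)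
  also have "\<dots> \<le> (\<Sum>k = 1..R. \<Sum>b = 1..R div k. mangoldt k * ?G (k * b))"
  proof (cases "U = 0")
    case False
    hence "V \<le> R" unfolding R(1) by simp
    thus ?thesis
      by (intro sum_mono2) (auto intro!: sum_nonneg mult_nonneg_nonneg simp: type_I_bound_nonneg mangoldt_nonneg)
  qed (simp add: R)
  also have "\<dots> = (\<Sum>t = 1..R. \<Sum>k | k dvd t. mangoldt k * ?G (k * (t div k)))"
    by (rule sum_divisors_regroup[symmetric])
  also have "\<dots> = (\<Sum>t = 1..R. ln (real t) * ?G t)"
  proof (rule sum.cong[OF refl])
    fix t assume t: "t \<in> {1..R}"
    have "(\<Sum>k | k dvd t. mangoldt k * ?G (k * (t div k))) = (\<Sum>k | k dvd t. mangoldt k) * ?G t"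
      unfolding sum_distrib_right by (intro sum.cong) auto
    thus "(\<Sum>k | k dvd t. mangoldt k * ?G (k * (t div k))) = ln (real t) * ?G t"
      using mangoldt_sum[of t, where ?'a = real] t by simp
  qed
  also have "\<dots> \<le> (\<Sum>t = 1..R. ln (real X) * ?G t)"
    using R by (intro sum_mono mult_right_mono type_I_bound_nonneg) auto
  finally show ?thesis by (simp add: sum_distrib_left)
qed

lemma vaughan_sum:
  fixes F :: "nat \<Rightarrow> complex"
  shows "(\<Sum>n = 1..X. of_real (mangoldt n) * F n) =
      (\<Sum>n = 1..X. of_real (if n \<le> V then mangoldt n else 0) * F n)
    + (\<Sum>b = 1..X. \<Sum>m = 1..X div b. of_real (if b \<le> U then moebius_mu b * ln (real m) else 0) * F (b * m))
    - (\<Sum>b = 1..X. \<Sum>m = 1..X div b. of_real (if b \<le> U then moebius_mu b * mangoldt_small V m else 0) * F (b * m))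
    + (\<Sum>b = 1..X. \<Sum>m = 1..X div b. of_real (if b \<le> U then 0 else moebius_mu b * mangoldt_large V m) * F (b * m))"
proof -
  have re: "(\<Sum>b = 1..X. \<Sum>m = 1..X div b. of_real (h b m) * F (b * m)) =
      (\<Sum>n = 1..X. of_real (\<Sum>b | b dvd n. h b (n div b)) * F n)" for h :: "nat \<Rightarrow> nat \<Rightarrow> real"
  proof -
    have "(\<Sum>n = 1..X. of_real (\<Sum>b | b dvd n. h b (n div b)) * F n)
        = (\<Sum>n = 1..X. \<Sum>b | b dvd n. of_real (h b (n div b)) * F (b * (n div b)))"
      unfolding of_real_sum sum_distrib_right by (intro sum.cong refl) auto
    also have "\<dots> = (\<Sum>b = 1..X. \<Sum>m = 1..X div b. of_real (h b m) * F (b * m))"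
      by (rule sum_divisors_regroup)
    finally show ?thesis ..
  qed
  have split: "of_real m * z = of_real a * z + of_real b * z - of_real e * z + of_real f * z"
    if "m = a + b - e + f" for m a b e f :: real and z :: complex
    unfolding that by (simp add: algebra_simps)
  show ?thesis
    unfolding re[where h = "\<lambda>b m. if b \<le> U then moebius_mu b * ln (real m) else 0"]
      re[where h = "\<lambda>b m. if b \<le> U then moebius_mu b * mangoldt_small V m else 0"]
      re[where h = "\<lambda>b m. if b \<le> U then 0 else moebius_mu b * mangoldt_large V m"]
    unfolding sum.distrib[symmetric] sum_subtractf[symmetric]
    by (intro sum.cong refl split vaughan_identity) auto
qed


section \<open>Type II sums and the combined estimate\<close>

lemma type_II_sum_le:
  assumes cop: "coprime c d" and d: "d > 0" and \<delta>: "\<delta> > 0" and L: "L > 0" and X: "X > 0"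
    and U: "real d * real L / \<delta> \<le> real U" "d \<le> U"
    and size: "real d * (real L)\<^sup>2 / \<delta> \<le> real X / real d"
    and spaced: "\<And>j. 1 \<le> j \<Longrightarrow> j \<le> L \<Longrightarrow> \<delta> \<le> dist_nearest_int (real d * (real d * x) * real j)"
  shows "norm (\<Sum>b = 1..X. \<Sum>m = 1..X div b. of_real (if b \<le> U then 0 else moebius_mu b * mangoldt_large (d * L) m) * prog_expi d c x (b * m))
    \<le> (1 + 2 * ln (real X)) * (3 * ln (real X) * (real X / real d) / sqrt (real L))"
proof -
  define N where "N = real X / real d"
  define V where "V = d * L"
  define P where "P = (\<lambda>b. norm (\<Sum>m = 1..X div b. of_real (mangoldt_large V m) * prog_expi d c x (b * m)))"
  define W where "W = 3 * ln (real X) * N / sqrt (real L)"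
  have lnX: "ln (real X) \<ge> 0" using X by (intro ln_ge_zero) auto
  have N: "N > 0" using X d by (simp add: N_def)
  have XN: "real X = real d * N" using d by (simp add: N_def)
  have W: "W \<ge> 0" using lnX N by (simp add: W_def)
  have Upos: "U > 0" using U d by simp
  \<comment> \<open>Either A V \<ge> X, and then m \<le> X/b \<le> V kills every coefficient, or d
    L/\<delta> \<le> A \<le> N/L. In the second case the bilinear bound multiplies out to four
    terms, each at most 2 N^2/L up to the squared logarithm.\<close>
  have block: "(\<Sum>b = A + 1..2 * A. P b) \<le> W" if A: "U \<le> A" for A
  proof (cases "X \<le> A * V")
    case True
    have "P b = 0" if b: "b \<in> {A + 1..2 * A}" for b
    proof -
      have "X div b \<le> V"
      proof -
        have "X \<le> b * V" using True b by (intro order_trans[OF True] mult_right_mono) auto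
        hence "X div b \<le> (b * V) div b" by (rule div_le_mono)
        thus ?thesis using b by simp
      qed
      hence "mangoldt_large V m = 0" if "m \<in> {1..X div b}" for m
        using that by (intro mangoldt_large_eq_0) auto
      thus ?thesis by (simp add: P_def)
    qed
    thus ?thesis using W by simp
  next
    case False
    have Apos: "A > 0" using A Upos by simp
    have dA: "real d \<le> real A" using A U by simp
    have "real (A * V) \<le> real X" using False by (intro of_nat_mono) simp
    hence "real A * real L * real d \<le> real X" by (simp add: V_def mult_ac)
    hence AN: "real A \<le> N / real L"
      unfolding N_def using d L by (simp add: field_simps)
    have Ad: "real d / (real A * \<delta>) \<le> 1 / real L"
    proof -
      have "real d * real L / \<delta> \<le> real A" using U A by linarith
      thus ?thesis using \<delta> L Apos by (simp add: field_simps)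
    qed
    have dL: "real d * real L / \<delta> \<le> N / real L"
      using size L \<delta> by (simp add: N_def[symmetric] field_simps power2_eq_square)
    have "(\<Sum>b = A + 1..2 * A. P b)\<^sup>2 \<le>
       (ln (real X))\<^sup>2 * real X * (real X / (real A * real d * real L) + 1) * (real A / real d + 1 + 2 * real L / \<delta>)"
      unfolding P_def
    proof (rule bilinear_block_le[OF cop d \<delta> L Apos])
      fix m assume m: "1 \<le> m" "m \<le> X"
      have "mangoldt_large V m \<le> ln (real m)" using m by (intro mangoldt_large_le_ln) auto
      also have "\<dots> \<le> ln (real X)" using m by simp
      finally show "\<bar>mangoldt_large V m\<bar> \<le> ln (real X)" using mangoldt_large_nonneg[of V m] by simp
    qed (use lnX spaced in auto)
    also have "\<dots> = (ln (real X))\<^sup>2 * (real d * N * (N / (real A * real L) + 1) * (real A / real d + 1 + 2 * real L / \<delta>))"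
      using d by (simp add: XN field_simps)
    also have "\<dots> \<le> (ln (real X))\<^sup>2 * (real d * N * (N / (real A * real L) + 1) * (2 * real A / real d + 2 * real L / \<delta>))"
    proof (intro mult_left_mono)
      have "1 \<le> real A / real d" using dA d by simp
      thus "real A / real d + 1 + 2 * real L / \<delta> \<le> 2 * real A / real d + 2 * real L / \<delta>" by simp
    qed (use N in auto)
    also have "real d * N * (N / (real A * real L) + 1) * (2 * real A / real d + 2 * real L / \<delta>)
       = 2 * N * (N / real L) + 2 * N * real A + 2 * N * N * (real d / (real A * \<delta>)) + 2 * N * (real d * real L / \<delta>)"
      using d L Apos \<delta> by (simp add: field_simps)
    also have "\<dots> \<le> 2 * N * (N / real L) + 2 * N * (N / real L) + 2 * N * N * (1 / real L) + 2 * N * (N / real L)"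
      using AN Ad dL N by (intro add_mono mult_left_mono) auto
    also have "\<dots> = 8 * N\<^sup>2 / real L" by (simp add: power2_eq_square)
    \<comment> \<open>Rounding 8 up to a square gives the constant 3 in \<open>W\<close>.\<close>
    also have "\<dots> \<le> 9 * N\<^sup>2 / real L" by (intro divide_right_mono) auto
    finally have "(\<Sum>b = A + 1..2 * A. P b)\<^sup>2 \<le> (ln (real X))\<^sup>2 * (9 * N\<^sup>2 / real L)"
      by (simp add: mult_left_mono)
    also have "\<dots> = W\<^sup>2" using L by (simp add: W_def power_mult_distrib power_divide)
    finally show ?thesis using W by (rule power2_le_imp_le)
  qed
  have dyadic: "(\<Sum>b = U + 1..2 ^ J * U. P b) \<le> real J * W" for J
  proof (induction J)
    case (Suc J)
    have "U \<le> 2 ^ J * U" by simp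
    have e: "2 ^ Suc J * U = 2 ^ J * U + 2 ^ J * U" "2 * (2 ^ J * U) = 2 ^ J * U + 2 ^ J * U" by simp_all
    have "(\<Sum>b = U + 1..2 ^ Suc J * U. P b) = (\<Sum>b = U + 1..2 ^ J * U. P b) + (\<Sum>b = 2 ^ J * U + 1..2 * (2 ^ J * U). P b)"
      unfolding e using \<open>U \<le> 2 ^ J * U\<close> by (intro sum.ub_add_nat) simp
    also have "\<dots> \<le> real J * W + W" using Suc block[of "2 ^ J * U"] \<open>U \<le> 2 ^ J * U\<close> by (intro add_mono) auto
    finally show ?case by (simp add: algebra_simps)
  qed auto
  obtain J where J: "2 ^ J \<le> X" "X < 2 ^ (J + 1)"
    using ex_power_ivl1[of 2 X] X by auto
  \<comment> \<open>The bound ln 2 \<ge> 1/2 converts the number of dyadic blocks into a logarithm;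
    block J + 1 is included so that 2^(J+1) U exceeds X.\<close>
  have J_le: "real (J + 1) \<le> 1 + 2 * ln (real X)"
  proof -
    have "real J * (1 / 2) \<le> real J * ln 2" using ln2_ge_two_thirds by (intro mult_left_mono) auto
    also have "\<dots> = ln (real (2 ^ J))" by (simp add: ln_realpow)
    also have "\<dots> \<le> ln (real X)" using J(1) X by (subst ln_le_cancel_iff) auto
    finally show ?thesis by simp
  qed
  have "norm (\<Sum>b = 1..X. \<Sum>m = 1..X div b. of_real (if b \<le> U then 0 else moebius_mu b * mangoldt_large V m) * prog_expi d c x (b * m))
     \<le> (\<Sum>b = 1..X. if b \<le> U then 0 else P b)"
  proof (rule sum_norm_le)
    fix b
    show "norm (\<Sum>m = 1..X div b. of_real (if b \<le> U then 0 else moebius_mu b * mangoldt_large V m) * prog_expi d c x (b * m))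
       \<le> (if b \<le> U then 0 else P b)"
    proof (cases "b \<le> U")
      case False
      have "(\<Sum>m = 1..X div b. of_real (if b \<le> U then 0 else moebius_mu b * mangoldt_large V m) * prog_expi d c x (b * m))
          = of_real (moebius_mu b) * (\<Sum>m = 1..X div b. of_real (mangoldt_large V m) * prog_expi d c x (b * m))"
        using False by (simp add: sum_distrib_left mult_ac)
      also have "norm \<dots> \<le> 1 * P b"
        unfolding norm_mult P_def using abs_moebius_le_1[of b] by (intro mult_right_mono) auto
      finally show ?thesis using False by simp
    qed simp
  qed
  also have "\<dots> = (\<Sum>b \<in> {b \<in> {1..X}. \<not> b \<le> U}. P b)"
    by (subst sum.inter_filter) (auto intro!: sum.cong)
  also have "\<dots> \<le> (\<Sum>b = U + 1..2 ^ (J + 1) * U. P b)"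
  proof (rule sum_mono2)
    have "X \<le> 2 ^ (J + 1) * U" using J(2) Upos by (metis less_imp_le_nat mult.right_neutral mult_le_mono less_one not_le nat_less_le)
    thus "{b \<in> {1..X}. \<not> b \<le> U} \<subseteq> {U + 1..2 ^ (J + 1) * U}" by auto
  qed (auto simp: P_def)
  also have "\<dots> \<le> real (J + 1) * W" by (rule dyadic)
  also have "\<dots> \<le> (1 + 2 * ln (real X)) * W" using W J_le by (intro mult_right_mono)
  finally show ?thesis unfolding V_def W_def N_def .
qed

text \<open>The condition \<open>size\<close> is dictated by type I: there are R = U V values of t,
  about d^2 L^2/\<delta>2 of them, each may cost 1/\<delta>1, and a further factor L is to be saved.
  The saving is only sqrt L because of the Cauchy-Schwarz step in type II.\<close>

theorem prime_expsum_le: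
  assumes cop: "coprime c d" and d: "d > 0" and L: "L > 0"
    and \<delta>1: "0 < \<delta>1" "\<delta>1 \<le> 1 / 2" and \<delta>2: "0 < \<delta>2" "\<delta>2 \<le> 1 / 2"
    and sp1: "\<And>j. 1 \<le> j \<Longrightarrow> j \<le> L \<Longrightarrow> \<delta>1 \<le> dist_nearest_int (real d * x * real j)"
    and sp2: "\<And>j. 1 \<le> j \<Longrightarrow> j \<le> L \<Longrightarrow> \<delta>2 \<le> dist_nearest_int (real d * (real d * x) * real j)"
    and size: "9 * (real d)\<^sup>2 * (real L) ^ 3 / (\<delta>1 * \<delta>2) \<le> real X / real d"
  shows "norm (\<Sum>n = 1..X. of_real (mangoldt n) * prog_expi d c x n)
     \<le> 8 * (1 + ln (real X))\<^sup>2 * (real X / real d) / sqrt (real L)"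
proof -
  define N where "N = real X / real d"
  \<comment> \<open>The two conditions of the type II estimate, \<open>A \<ge> d L/\<delta>2\<close> and \<open>A \<le> N/L\<close>, dictate \<open>U\<close> and \<open>V\<close>.\<close>
  define V where "V = d * L"
  define U where "U = nat \<lceil>real d * real L / \<delta>2\<rceil>"
  define R where "R = U * V"
  define l where "l = ln (real X)"
  define E where "E = N / sqrt (real L)"
  let ?F = "prog_expi d c x" and ?G = "type_I_bound d (real d * x) X"
  have d1: "real d \<ge> 1" and L1: "real L \<ge> 1" using d L by auto
  have size': "9 * (real d)\<^sup>2 * (real L)^2 / (\<delta>1 * \<delta>2) \<le> N / real L"
    using size L1 \<delta>1 \<delta>2 by (simp add: N_def[symmetric] field_simps power2_eq_square power3_eq_cube)
  have q: "1 \<le> real d * real L / \<delta>2"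
  proof -
    have "1 * 1 \<le> real d * real L" using d1 L1 by (intro mult_mono) auto
    thus ?thesis using \<delta>2 by (simp add: field_simps)
  qed
  have U_ge: "real d * real L / \<delta>2 \<le> real U" unfolding U_def by linarith
  have U_le: "real U \<le> 2 * (real d * real L / \<delta>2)"   proof -
    have "real U = of_int \<lceil>real d * real L / \<delta>2\<rceil>" unfolding U_def using q by (intro of_nat_nat) linarith
    thus ?thesis using q of_int_ceiling_le_add_one[of "real d * real L / \<delta>2"] by linarith
  qed
  have dU: "d \<le> U"
  proof -
    have "real d * 1 \<le> real d * (real L / \<delta>2)"
      using L1 \<delta>2 by (intro mult_left_mono) (auto simp: field_simps)
    also have "\<dots> \<le> real U" using U_ge by simp
    finally show ?thesis by simp
  qed
  have Vpos: "V > 0" using d L by (simp add: V_def)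
  have Upos: "U > 0" using dU d by simp
  have R_le: "real R \<le> 2 * ((real d)\<^sup>2 * (real L)\<^sup>2 / \<delta>2)"
  proof -
    have "real R \<le> 2 * (real d * real L / \<delta>2) * (real d * real L)"
      unfolding R_def V_def of_nat_mult by (intro mult_right_mono U_le) auto
    thus ?thesis by (simp add: power2_eq_square mult_ac)
  qed
  have TI: "(3 * real R + real L) / \<delta>1 \<le> N / real L"
  proof -
    have "real L \<le> (real d)\<^sup>2 * (real L)\<^sup>2 / \<delta>2"
    proof -
      have "real L * \<delta>2 \<le> real L * 1" using \<delta>2 by (intro mult_left_mono) auto
      also have "\<dots> \<le> (real d)\<^sup>2 * (real L)\<^sup>2"
      proof -
        have "1 * (real L * 1) \<le> (real d * real d) * (real L * real L)"
          using d1 L1 mult_mono[of 1 "real d" 1 "real d"] by (intro mult_mono) auto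
        thus ?thesis by (simp add: power2_eq_square)
      qed
      finally show ?thesis using \<delta>2 by (simp add: field_simps)
    qed
    \<comment> \<open>The term 3 R accounts for 6 and L for 1; this is the source of the 9 in
      \<open>size\<close>, with some room.\<close>
    hence "3 * real R + real L \<le> 9 * ((real d)\<^sup>2 * (real L)\<^sup>2 / \<delta>2)" using R_le by linarith
    hence "(3 * real R + real L) / \<delta>1 \<le> 9 * ((real d)\<^sup>2 * (real L)\<^sup>2 / \<delta>2) / \<delta>1"
      using \<delta>1 by (intro divide_right_mono) auto
    also have "\<dots> \<le> N / real L" using size' by (simp add: mult_ac)
    finally show ?thesis .
  qed
  have Nn: "N \<ge> 0" by (simp add: N_def)
  have RX: "real R \<le> real X"
  proof -
    have "real R \<le> (3 * real R + real L) / \<delta>1"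
      using \<delta>1 mult_left_mono[of \<delta>1 1 "real R"] by (simp add: pos_le_divide_eq)
    also have "\<dots> \<le> N / real L" by (rule TI)
    also have "\<dots> \<le> N" using Nn L1 by (simp add: divide_le_eq mult_left_mono[of 1 "real L" N, simplified])
    also have "\<dots> \<le> real X" unfolding N_def using d1 by (simp add: divide_le_eq mult_left_mono[of 1 "real d" "real X", simplified])
    finally show ?thesis .
  qed
  have Rpos: "R > 0" using Upos Vpos by (simp add: R_def)
  have Xpos: "X > 0" using RX Rpos by linarith
  have l: "l \<ge> 0" unfolding l_def using Xpos by (intro ln_ge_zero) auto
  have NLE: "N / real L \<le> E"
  proof -
    have "sqrt (real L) \<le> real L" using L1 by (intro real_le_lsqrt) (auto simp: power2_eq_square)
    thus ?thesis unfolding E_def using Nn L1 by (intro divide_left_mono) auto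
  qed
  have E: "E \<ge> 0" using Nn by (simp add: E_def)
  \<comment> \<open>Only n \<le> V = d L contribute here, so each term may be bounded
    trivially.\<close>
  have T0: "norm (\<Sum>n = 1..X. of_real (if n \<le> V then mangoldt n else 0) * ?F n) \<le> l * E"
  proof -
    have "norm (\<Sum>n = 1..X. of_real (if n \<le> V then mangoldt n else 0) * ?F n) \<le> (\<Sum>n = 1..X. if n \<le> V then l else 0)"
    proof (rule sum_norm_le)
      fix n assume n: "n \<in> {1..X}"
      have "mangoldt n * norm (?F n) \<le> mangoldt n * 1"
        by (intro mult_left_mono norm_prog_expi_le_1 mangoldt_nonneg)
      also have "\<dots> \<le> ln (real n)" using mangoldt_le[of n] n by simp
      also have "\<dots> \<le> l" unfolding l_def using n by simp
      finally show "norm (of_real (if n \<le> V then mangoldt n else 0) * ?F n) \<le> (if n \<le> V then l else 0)"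
        by (simp add: norm_mult)
    qed
    also have "\<dots> = (\<Sum>n \<in> {n \<in> {1..X}. n \<le> V}. l)" by (rule sum.inter_filter[symmetric]) simp
    also have "\<dots> \<le> (\<Sum>n = 1..V. l)" using l by (intro sum_mono2) auto
    also have "\<dots> = l * real V" by simp
    also have "real V \<le> 9 * (real d)\<^sup>2 * (real L)^2 / (\<delta>1 * \<delta>2)"
    proof -
      have "real V \<le> real V * real V" using Vpos by simp
      also have "\<dots> \<le> 9 * (real V * real V)" by simp
      also have "\<dots> \<le> 9 * (real V * real V) / (\<delta>1 * \<delta>2)"
      proof -
        have "\<delta>1 * \<delta>2 \<le> 1" using \<delta>1 \<delta>2 by (intro mult_le_one) auto
        hence "9 * (real V * real V) * (\<delta>1 * \<delta>2) \<le> 9 * (real V * real V) * 1" by (intro mult_left_mono) auto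
        thus ?thesis using \<delta>1 \<delta>2 by (simp add: pos_le_divide_eq)
      qed
      finally show ?thesis by (simp add: V_def power2_eq_square mult_ac)
    qed
    also have "\<dots> \<le> E" using size' NLE by linarith
    finally show ?thesis using l by (simp add: mult_left_mono)
  qed
  have G: "(\<Sum>t = 1..R. ?G t) \<le> (2 + l) * E"
  proof -
    have "(\<Sum>t = 1..R. ?G t) \<le> N / real L * (1 + ln (real R)) + (3 * real R + real L) / \<delta>1"
      by (rule sum_type_I_le[OF \<delta>1 Nn L Rpos _ type_I_bound_nonneg _ sp1])
         (auto simp: type_I_bound_def N_def)
    also have "\<dots> \<le> E * (1 + l) + E"
      using TI NLE E Rpos RX by (intro add_mono mult_mono) (auto simp: l_def)
    finally show ?thesis by (simp add: algebra_simps)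
  qed
  have UR: "U \<le> R" using Vpos by (simp add: R_def)
  have size2: "real d * (real L)\<^sup>2 / \<delta>2 \<le> real X / real d"
  proof -
    have "real d * (real L)\<^sup>2 / \<delta>2 \<le> (real d * (real L)\<^sup>2 / \<delta>2) * (9 * real d * real L / \<delta>1)"
    proof -
      have "1 * 1 \<le> real d * real L" using d1 L1 by (intro mult_mono) auto
      hence "1 \<le> 9 * real d * real L / \<delta>1" using \<delta>1 by (simp add: field_simps)
      from mult_left_mono[OF this, of "real d * (real L)\<^sup>2 / \<delta>2"] show ?thesis using \<delta>2 by simp
    qed
    also have "\<dots> = 9 * (real d)\<^sup>2 * (real L) ^ 3 / (\<delta>1 * \<delta>2)"
      by (simp add: power2_eq_square power3_eq_cube mult_ac)
    finally show ?thesis using size by linarith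
  qed
  have T1: "norm (\<Sum>b = 1..X. \<Sum>m = 1..X div b. of_real (if b \<le> U then moebius_mu b * ln (real m) else 0) * ?F (b * m)) \<le> l * ((2 + l) * E)"
    using order_trans[OF type_I_ln_sum_le[OF cop d Xpos UR, of x] mult_left_mono[OF G l, unfolded l_def]]
    by (simp add: l_def)
  have T2: "norm (\<Sum>b = 1..X. \<Sum>m = 1..X div b. of_real (if b \<le> U then moebius_mu b * mangoldt_small V m else 0) * ?F (b * m)) \<le> l * ((2 + l) * E)"
    using order_trans[OF type_I_mangoldt_sum_le[OF cop d Xpos R_def, of x] mult_left_mono[OF G l, unfolded l_def]] RX
    by (simp add: l_def)
  have T3: "norm (\<Sum>b = 1..X. \<Sum>m = 1..X div b. of_real (if b \<le> U then 0 else moebius_mu b * mangoldt_large V m) * ?F (b * m)) \<le> (1 + 2 * l) * (3 * l * E)"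
    using type_II_sum_le[OF cop d \<delta>2(1) L Xpos U_ge dU size2 sp2] unfolding V_def E_def N_def l_def by simp
  have tri: "norm (a + b - e + f) \<le> A + B + B' + D" if "norm a \<le> A" "norm b \<le> B" "norm e \<le> B'" "norm f \<le> D"
    for a b e f :: complex and A B B' D
    using that norm_triangle_ineq[of "a + b - e" f] norm_triangle_ineq4[of "a + b" e] norm_triangle_ineq[of a b] by linarith
  have "norm (\<Sum>n = 1..X. of_real (mangoldt n) * ?F n) \<le> l * E + l * ((2 + l) * E) + l * ((2 + l) * E) + (1 + 2 * l) * (3 * l * E)"
    unfolding vaughan_sum[where X = X and F = ?F and V = V and U = U] by (rule tri[OF T0 T1 T2 T3])
  \<comment> \<open>The four contributions l, l (2 + l) twice and 3 l (1 + 2 l) add up to exactly 8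
    l (1 + l).\<close>
  also have "\<dots> = 8 * (l * (1 + l)) * E" by (simp add: algebra_simps)
  also have "\<dots> \<le> 8 * (1 + l)\<^sup>2 * E"
    using E l by (intro mult_right_mono mult_left_mono) (auto simp: power2_eq_square mult_right_mono)
  finally show ?thesis by (simp add: E_def l_def N_def)
qed

section \<open>A discrete Erdos-Turan inequality\<close>

lemma card_nat_between_le:
  fixes x y :: real
  assumes "x \<le> y" "\<And>r. r \<in> S \<Longrightarrow> x \<le> real r \<and> real r \<le> y"
  shows "real (card (S :: nat set)) \<le> y - x + 1"
proof (cases "S = {}")
  case False
  have "S \<subseteq> {..nat \<lfloor>y\<rfloor>}" using assms(2) by (auto simp: le_nat_floor)
  hence fin: "finite S" by (rule finite_subset) simp
  have "S \<subseteq> {Min S..Max S}" using fin by auto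
  hence "card S \<le> card {Min S..Max S}" by (intro card_mono) auto
  moreover have "Min S \<le> Max S" using fin False by simp
  moreover have "x \<le> real (Min S)" "real (Max S) \<le> y"
    using assms(2) Min_in[OF fin False] Max_in[OF fin False] by auto
  ultimately show ?thesis by (simp add: of_nat_diff)
qed (use assms in auto)

section \<open>The Fejer kernel on the grid r/H\<close>

lemma sum_roots_of_unity:
  fixes H j k :: nat
  assumes "j < H" "k < H" "j \<noteq> k"
  shows "(\<Sum>r<H. expi ((real j - real k) * (real r / real H))) = 0"
proof -
  define u where "u = (real j - real k) / real H"
  have H: "H > 0" using assms by simp
  have ne: "expi u \<noteq> 1"
  proof
    assume "expi u = 1"
    hence "cos (2 * pi * u) = 1" by (metis cis.sel(1) one_complex.sel(1))
    then obtain n :: int where n: "2 * pi * u = of_int n * 2 * pi"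
      using cos_one_2pi_int by auto
    hence "u = of_int n" by simp
    hence "real j - real k = of_int n * real H" using H by (simp add: u_def field_simps)
    hence "of_int (int j - int k) = real_of_int (n * int H)" by simp
    hence eq: "int j - int k = n * int H" by (simp only: of_int_eq_iff)
    have "\<bar>int j - int k\<bar> < int H" using assms by linarith
    hence "\<bar>n\<bar> * int H < 1 * int H" by (simp add: eq abs_mult)
    hence "n = 0" by (simp add: H)
    thus False using eq assms by simp
  qed
  have "(\<Sum>r<H. expi ((real j - real k) * (real r / real H))) = (\<Sum>r<H. expi u ^ r)"
    by (intro sum.cong refl, subst Complex.DeMoivre) (simp add: u_def mult_ac)
  also have "\<dots> = (expi u ^ H - 1) / (expi u - 1)" by (rule geometric_sum[OF ne])
  also have "expi u ^ H = 1"
  proof -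
    have "expi u ^ H = cis (2 * pi * of_int (int j - int k))"
      by (subst Complex.DeMoivre) (use H in \<open>simp add: u_def mult_ac\<close>)
    also have "\<dots> = 1" by (intro cis_multiple_2pi Ints_of_int)
    finally show ?thesis .
  qed
  finally show ?thesis by simp
qed

text \<open>As a squared geometric sum the kernel is visibly nonnegative and decays away from the
  integers. The normalisation gives mean value 1 over a period and the value H at 0.\<close>

definition fejer :: "nat \<Rightarrow> real \<Rightarrow> real" where
  "fejer H t = (norm (\<Sum>j<H. expi (real j * t)))\<^sup>2 / real H"

lemma fejer_nonneg: "0 \<le> fejer H t"
  by (simp add: fejer_def)

lemma fejer_expand:
  "complex_of_real (fejer H t) = (\<Sum>j<H. \<Sum>k<H. expi ((real j - real k) * t)) / of_nat H"
proof -
  have "complex_of_real ((norm (\<Sum>j<H. expi (real j * t)))\<^sup>2) = (\<Sum>j<H. \<Sum>k<H. expi ((real j - real k) * t))"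
    unfolding complex_norm_square cnj_sum sum_product
    by (intro sum.cong refl) (simp add: cis_cnj cis_mult algebra_simps)
  thus ?thesis by (simp add: fejer_def)
qed

text \<open>All frequencies j - k lie strictly between -H and H, so orthogonality on the grid leaves
  only the diagonal. Up to the factor H the shifts form an exact partition of unity.\<close>

lemma sum_fejer_shifts:
  assumes H: "H > 0"
  shows "(\<Sum>r<H. fejer H (t - real r / real H)) = real H"
proof -
  have "complex_of_real (\<Sum>r<H. fejer H (t - real r / real H))
      = (\<Sum>r<H. \<Sum>j<H. \<Sum>k<H. expi ((real j - real k) * (t - real r / real H))) / of_nat H"
    by (simp add: fejer_expand sum_divide_distrib)
  also have "(\<Sum>r<H. \<Sum>j<H. \<Sum>k<H. expi ((real j - real k) * (t - real r / real H)))
      = (\<Sum>j<H. \<Sum>k<H. \<Sum>r<H. expi ((real j - real k) * (t - real r / real H)))"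
    by (rule trans[OF sum.swap], rule sum.cong[OF refl], rule sum.swap)
  also have "\<dots> = (\<Sum>j<H. \<Sum>k<H. if k = j then of_nat H else 0)"
  proof (intro sum.cong refl)
    fix j k assume jk: "j \<in> {..<H}" "k \<in> {..<H}"
    have "(\<Sum>r<H. expi ((real j - real k) * (t - real r / real H)))
        = (\<Sum>r<H. expi ((real j - real k) * t) * expi ((real k - real j) * (real r / real H)))"
      by (intro sum.cong refl) (simp add: cis_mult algebra_simps diff_divide_distrib)
    also have "\<dots> = expi ((real j - real k) * t) * (\<Sum>r<H. expi ((real k - real j) * (real r / real H)))"
      by (simp add: sum_distrib_left)
    also have "\<dots> = (if k = j then of_nat H else 0)"
    proof (cases "k = j")
      case False
      show ?thesis using sum_roots_of_unity[of k H j] jk False by simp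
    qed simp
    finally show "(\<Sum>r<H. expi ((real j - real k) * (t - real r / real H))) = (if k = j then of_nat H else 0)" .
  qed
  also have "\<dots> = (of_nat H * of_nat H :: complex)" by simp
  finally have "complex_of_real (\<Sum>r<H. fejer H (t - real r / real H)) = complex_of_real (real H)"
    using H by simp
  thus ?thesis by (simp only: of_real_eq_iff)
qed

lemma fejer_le:
  assumes "0 < \<delta>" "\<delta> \<le> dist_nearest_int t"
  shows "fejer H t \<le> 1 / (\<delta>\<^sup>2 * real H)"
proof -
  have "norm (\<Sum>j<H. expi (real j * t)) = norm (\<Sum>j = 0..<H. expi (t * real j))"
    by (simp add: atLeast0LessThan mult.commute)
  also have "\<dots> \<le> 1 / dist_nearest_int t" by (rule norm_sum_expi_le) (use assms in auto)
  also have "\<dots> \<le> 1 / \<delta>" using assms by (intro divide_left_mono) auto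
  finally have "(norm (\<Sum>j<H. expi (real j * t)))\<^sup>2 \<le> (1 / \<delta>)\<^sup>2" by (intro power_mono) auto
  hence "fejer H t \<le> (1 / \<delta>)\<^sup>2 / real H" unfolding fejer_def by (intro divide_right_mono) auto
  thus ?thesis by (simp add: power_divide)
qed

text \<open>In the expanded square each of the H diagonal terms contributes the total weight, and
  every term is allowed an error S; division by H gives the claim. Negative frequencies reduce to
  positive ones by conjugation, as the weights are real.\<close>

lemma weighted_fejer_sum_le:
  fixes w y :: "'a \<Rightarrow> real"
  assumes w: "\<And>m. m \<in> M \<Longrightarrow> 0 \<le> w m" and S0: "S \<ge> 0"
    and S: "\<And>k. 1 \<le> k \<Longrightarrow> k < H \<Longrightarrow> norm (\<Sum>m\<in>M. of_real (w m) * expi (real k * y m)) \<le> S"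
    and H: "H > 0"
  shows "(\<Sum>m\<in>M. w m * fejer H (y m - t)) \<le> (\<Sum>m\<in>M. w m) + real H * S"
proof -
  define W where "W = (\<Sum>m\<in>M. w m)"
  have W0: "W \<ge> 0" unfolding W_def by (intro sum_nonneg w)
  have S': "norm (\<Sum>m\<in>M. of_real (w m) * expi ((real j - real k) * (y m - t))) \<le> (if j = k then W else 0) + S"
    if jk: "j < H" "k < H" for j k
  proof -
    have shift: "norm (\<Sum>m\<in>M. of_real (w m) * expi (u * (y m - t))) = norm (\<Sum>m\<in>M. of_real (w m) * expi (u * y m))" for u
    proof -
      have "(\<Sum>m\<in>M. of_real (w m) * expi (u * (y m - t))) = expi (- u * t) * (\<Sum>m\<in>M. of_real (w m) * expi (u * y m))"
        unfolding sum_distrib_left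
        by (intro sum.cong refl) (simp add: mult.left_commute cis_mult algebra_simps)
      thus ?thesis by (simp add: norm_mult)
    qed
    consider "j = k" | "k < j" | "j < k" by linarith
    thus ?thesis
    proof cases
      case 1
      have "norm (\<Sum>m\<in>M. complex_of_real (w m)) = W"
        unfolding of_real_sum[symmetric] W_def[symmetric] using W0 by simp
      thus ?thesis using 1 S0 by simp
    next
      case 2
      hence "real j - real k = real (j - k)" by (simp add: of_nat_diff)
      thus ?thesis using S[of "j - k"] 2 jk unfolding shift by simp
    next
      case 3
      hence e: "real j - real k = - real (k - j)" by (simp add: of_nat_diff)
      have "(\<Sum>m\<in>M. of_real (w m) * expi ((real j - real k) * y m)) = cnj (\<Sum>m\<in>M. of_real (w m) * expi (real (k - j) * y m))"
        unfolding e by (simp add: cis_cnj)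
      hence "norm (\<Sum>m\<in>M. of_real (w m) * expi ((real j - real k) * y m)) = norm (\<Sum>m\<in>M. of_real (w m) * expi (real (k - j) * y m))"
        by (simp only: complex_mod_cnj)
      thus ?thesis using S[of "k - j"] 3 jk unfolding shift by simp
    qed
  qed
  have "complex_of_real (\<Sum>m\<in>M. w m * fejer H (y m - t))
      = (\<Sum>m\<in>M. \<Sum>j<H. \<Sum>k<H. of_real (w m) * expi ((real j - real k) * (y m - t))) / of_nat H"
    by (simp add: fejer_expand sum_divide_distrib sum_distrib_left)
  also have "(\<Sum>m\<in>M. \<Sum>j<H. \<Sum>k<H. of_real (w m) * expi ((real j - real k) * (y m - t)))
      = (\<Sum>j<H. \<Sum>k<H. \<Sum>m\<in>M. of_real (w m) * expi ((real j - real k) * (y m - t)))"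
    by (rule trans[OF sum.swap], rule sum.cong[OF refl], rule sum.swap)
  finally have eq: "complex_of_real (\<Sum>m\<in>M. w m * fejer H (y m - t)) = \<dots> / of_nat H" .
  have "(\<Sum>m\<in>M. w m * fejer H (y m - t)) \<le> norm (complex_of_real (\<Sum>m\<in>M. w m * fejer H (y m - t)))"
    unfolding norm_of_real by (rule abs_ge_self)
  also have "\<dots> \<le> (\<Sum>j<H. \<Sum>k<H. (if j = k then W else 0) + S) / real H"
    unfolding eq norm_divide norm_of_nat
    by (intro divide_right_mono sum_norm_le S') auto
  also have "(\<Sum>j<H. \<Sum>k<H. (if j = k then W else 0) + S) = real H * W + real H * real H * S"
    by (simp add: sum.distrib algebra_simps)
  also have "\<dots> / real H = W + real H * S" using H by (simp add: field_simps)
  finally show ?thesis by (simp add: W_def)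
qed

text \<open>If y lies in [a, b) modulo 1, the shifts close to the interval carry at least the share
  1 - \<delta> of the total H, so their sum majorises the indicator of [a, b) up to that factor. The
  choice H = h^3, \<delta> = 1/h balances the tail: it is at most 1/\<delta>^2 = h^2 = H
  \<delta>.\<close>

lemma weighted_discrepancy_upper:
  fixes w y :: "'a \<Rightarrow> real"
  assumes fin: "finite M" and w: "\<And>m. m \<in> M \<Longrightarrow> 0 \<le> w m" and S0: "S \<ge> 0" and h: "h > 0"
    and S: "\<And>k. 1 \<le> k \<Longrightarrow> k < h ^ 3 \<Longrightarrow> norm (\<Sum>m\<in>M. of_real (w m) * expi (real k * y m)) \<le> S"
    and ab: "0 \<le> a" "a \<le> b" "b \<le> 1"
  shows "(\<Sum>m | m \<in> M \<and> a \<le> frac (y m) \<and> frac (y m) < b. w m)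
     \<le> (b - a) * (\<Sum>m\<in>M. w m) + 8 * (\<Sum>m\<in>M. w m) / real h + real h ^ 3 * S"
proof -
  define H where "H = h ^ 3"
  define W where "W = (\<Sum>m\<in>M. w m)"
  define \<delta> where "\<delta> = 1 / real h"
  \<comment> \<open>The windows at 0 and 1 deal with wrapping modulo 1: for a grid point outside
    them, no nonzero integer translate can bring y within \<delta>.\<close>
  define A where "A = {r. r < H \<and> (a - \<delta> \<le> real r / real H \<and> real r / real H \<le> b + \<delta> \<or>
       0 \<le> real r / real H \<and> real r / real H \<le> \<delta> \<or> 1 - \<delta> \<le> real r / real H \<and> real r / real H \<le> 1)}"
  have H: "H > 0" "real H > 0" "H = h ^ 3" "h \<le> H"
    using h self_le_power[of h 3] by (auto simp: H_def)
  have W0: "W \<ge> 0" unfolding W_def by (intro sum_nonneg w)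
  have \<delta>: "\<delta> > 0" using h by (simp add: \<delta>_def)
  have A_sub: "A \<subseteq> {..<H}" by (auto simp: A_def)
  have fA: "finite A" using A_sub by (rule finite_subset) simp
  have cardA: "real (card A) \<le> real H * (b - a + 7 * \<delta>)" "real (card A) \<le> real H"
  proof -
    let ?B = "\<lambda>p q. {r. r < H \<and> p \<le> real r / real H \<and> real r / real H \<le> q}"
    have B: "real (card (?B p q)) \<le> real H * (q - p) + 1" if "p \<le> q" for p q
    proof -
      have "real (card (?B p q)) \<le> q * real H - p * real H + 1"
        by (rule card_nat_between_le) (use H that in \<open>auto simp: field_simps\<close>)
      thus ?thesis by (simp add: algebra_simps)
    qed
    have "A = ?B (a - \<delta>) (b + \<delta>) \<union> (?B 0 \<delta> \<union> ?B (1 - \<delta>) 1)" by (auto simp: A_def)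
    hence "card A \<le> card (?B (a - \<delta>) (b + \<delta>)) + (card (?B 0 \<delta>) + card (?B (1 - \<delta>) 1))"
      by (metis (no_types, lifting) card_Un_le add_left_mono order_trans)
    hence "real (card A) \<le> real (card (?B (a - \<delta>) (b + \<delta>))) + (real (card (?B 0 \<delta>)) + real (card (?B (1 - \<delta>) 1)))"
      by linarith
    also have "\<dots> \<le> (real H * (b + \<delta> - (a - \<delta>)) + 1) + ((real H * (\<delta> - 0) + 1) + (real H * (1 - (1 - \<delta>)) + 1))"
      using \<delta> ab by (intro add_mono B) auto
    also have "\<dots> = real H * (b - a + 4 * \<delta>) + 3" by (simp add: algebra_simps)
    \<comment> \<open>The three counting errors of 1 are absorbed by H \<delta> \<ge> 1, which turns
      4 \<delta> into 7 \<delta>.\<close>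
    also have "3 \<le> 3 * (real H * \<delta>)" 
    proof -
      have "real h \<le> real H" using H(4) by simp
      hence "1 \<le> real H * \<delta>" using h by (simp add: \<delta>_def del: of_nat_le_iff)
      thus ?thesis by simp
    qed
    finally show "real (card A) \<le> real H * (b - a + 7 * \<delta>)" by (simp add: algebra_simps)
    show "real (card A) \<le> real H" using card_mono[OF _ A_sub] by simp
  qed
  have pointwise: "real H * (1 - \<delta>) \<le> (\<Sum>r\<in>A. fejer H (y m - real r / real H))"
    if m: "a \<le> frac (y m)" "frac (y m) < b" for m
  proof -
    have far: "\<delta> \<le> dist_nearest_int (y m - real r / real H)" if r: "r \<in> {..<H} - A" for r
    proof -
      define s where "s = real r / real H"
      have s: "s < a - \<delta> \<or> b + \<delta> < s" "\<delta> < s" "s < 1 - \<delta>"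
        using r H unfolding A_def s_def by auto
      define k where "k = round (y m - s) - \<lfloor>y m\<rfloor>"
      have "dist_nearest_int (y m - s) = \<bar>frac (y m) - s - of_int k\<bar>"
        by (simp add: dist_nearest_int_def k_def frac_def)
      also have "\<dots> \<ge> \<delta>"
      proof -
        consider "k = 0" | "k \<ge> 1" | "k \<le> -1" by linarith
        thus ?thesis
        proof cases
          case 2
          hence "real_of_int k \<ge> 1" by simp
          thus ?thesis using s m ab by linarith
        next
          case 3
          hence "real_of_int k \<le> -1" by linarith
          thus ?thesis using s m ab by linarith
        qed (use s m in linarith)
      qed
      finally show ?thesis by (simp add: s_def)
    qed
    have "(\<Sum>r\<in>{..<H} - A. fejer H (y m - real r / real H)) \<le> real (card ({..<H} - A)) * (1 / (\<delta>\<^sup>2 * real H))"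
      by (intro sum_bounded_above fejer_le far \<delta>)
    also have "\<dots> \<le> real H * (1 / (\<delta>\<^sup>2 * real H))"
    proof (rule mult_right_mono)
      show "real (card ({..<H} - A)) \<le> real H"
        using card_mono[of "{..<H}" "{..<H} - A"] by simp
    qed simp
    also have "\<dots> = real H * \<delta>"
      using h by (simp add: H(3) \<delta>_def field_simps power2_eq_square power3_eq_cube)
    finally have "(\<Sum>r\<in>{..<H} - A. fejer H (y m - real r / real H)) \<le> real H * \<delta>" .
    moreover have "(\<Sum>r\<in>{..<H} - A. fejer H (y m - real r / real H)) + (\<Sum>r\<in>A. fejer H (y m - real r / real H)) = real H"
      using sum.subset_diff[OF A_sub, of "\<lambda>r. fejer H (y m - real r / real H)"] sum_fejer_shifts[OF H(1), of "y m"] by simp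
    ultimately show ?thesis by (simp add: algebra_simps)
  qed
  let ?I = "{m \<in> M. a \<le> frac (y m) \<and> frac (y m) < b}"
  have "(\<Sum>m\<in>?I. w m) * (real H * (1 - \<delta>)) = (\<Sum>m\<in>?I. w m * (real H * (1 - \<delta>)))"
    by (simp add: sum_distrib_right)
  also have "\<dots> \<le> (\<Sum>m\<in>?I. w m * (\<Sum>r\<in>A. fejer H (y m - real r / real H)))"
    by (intro sum_mono mult_left_mono pointwise w) auto
  also have "\<dots> \<le> (\<Sum>m\<in>M. w m * (\<Sum>r\<in>A. fejer H (y m - real r / real H)))"
    using fin by (intro sum_mono2) (auto intro!: mult_nonneg_nonneg sum_nonneg fejer_nonneg w)
  also have "\<dots> = (\<Sum>r\<in>A. \<Sum>m\<in>M. w m * fejer H (y m - real r / real H))"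
    unfolding sum_distrib_left by (rule sum.swap)
  also have "\<dots> \<le> real (card A) * (W + real H * S)"
    unfolding W_def
    by (intro sum_bounded_above weighted_fejer_sum_le w S0 H) (use S H in auto)
  also have "\<dots> = real (card A) * W + real (card A) * (real H * S)" by (simp add: algebra_simps)
  \<comment> \<open>The sharp bound on the number of shifts is spent on the total weight, the crude
    bound H on the exponential sums.\<close>
  also have "\<dots> \<le> (real H * (b - a + 7 * \<delta>)) * W + real H * (real H * S)"
    using W0 S0 cardA by (intro add_mono mult_right_mono) auto
  finally have "(\<Sum>m\<in>?I. w m) * (real H * (1 - \<delta>)) \<le> real H * ((b - a + 7 * \<delta>) * W + real H * S)"
    by (simp add: algebra_simps)
  hence "real H * ((\<Sum>m\<in>?I. w m) * (1 - \<delta>)) \<le> real H * ((b - a + 7 * \<delta>) * W + real H * S)"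
    by (simp add: mult_ac)
  hence 1: "(\<Sum>m\<in>?I. w m) * (1 - \<delta>) \<le> (b - a + 7 * \<delta>) * W + real H * S"
    using H by simp
  \<comment> \<open>Adding W \<delta> instead of dividing by 1 - \<delta> turns 7 into 8 and stays
    valid for h = 1, where 1 - \<delta> = 0.\<close>
  have "(\<Sum>m\<in>?I. w m) \<le> W"
    unfolding W_def using fin w by (intro sum_mono2) auto
  hence "(\<Sum>m\<in>?I. w m) * \<delta> \<le> W * \<delta>" using \<delta> by (intro mult_right_mono) auto
  with 1 have "(\<Sum>m\<in>?I. w m) \<le> (b - a + 8 * \<delta>) * W + real H * S"
    by (simp add: algebra_simps)
  thus ?thesis by (simp add: \<delta>_def W_def H_def algebra_simps)
qed

text \<open>The upper bound for the complement [\<gamma>, 1) is the lower bound for [0,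
  \<gamma>).\<close>

theorem weighted_discrepancy:
  fixes w y :: "'a \<Rightarrow> real"
  assumes fin: "finite M" and w: "\<And>m. m \<in> M \<Longrightarrow> 0 \<le> w m" and S0: "S \<ge> 0" and h: "h > 0"
    and S: "\<And>k. 1 \<le> k \<Longrightarrow> k < h ^ 3 \<Longrightarrow> norm (\<Sum>m\<in>M. of_real (w m) * expi (real k * y m)) \<le> S"
    and \<gamma>: "0 \<le> \<gamma>" "\<gamma> \<le> 1"
  shows "\<bar>(\<Sum>m | m \<in> M \<and> frac (y m) < \<gamma>. w m) - \<gamma> * (\<Sum>m\<in>M. w m)\<bar>
     \<le> 8 * (\<Sum>m\<in>M. w m) / real h + real h ^ 3 * S"
proof -
  define W where "W = (\<Sum>m\<in>M. w m)"
  have upper: "(\<Sum>m | m \<in> M \<and> 0 \<le> frac (y m) \<and> frac (y m) < \<gamma>. w m) \<le> (\<gamma> - 0) * W + 8 * W / real h + real h ^ 3 * S"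
    unfolding W_def using \<gamma> by (intro weighted_discrepancy_upper assms) auto
  have lower: "(\<Sum>m | m \<in> M \<and> \<gamma> \<le> frac (y m) \<and> frac (y m) < 1. w m) \<le> (1 - \<gamma>) * W + 8 * W / real h + real h ^ 3 * S"
    unfolding W_def using \<gamma> by (intro weighted_discrepancy_upper assms) auto
  have "W = (\<Sum>m\<in>{m \<in> M. frac (y m) < \<gamma>} \<union> {m \<in> M. \<gamma> \<le> frac (y m)}. w m)"
    unfolding W_def by (rule sum.cong) auto
  also have "\<dots> = (\<Sum>m | m \<in> M \<and> frac (y m) < \<gamma>. w m) + (\<Sum>m | m \<in> M \<and> \<gamma> \<le> frac (y m). w m)"
    using fin by (intro sum.union_disjoint) auto
  finally have "W = \<dots>" .
  moreover have "{m \<in> M. 0 \<le> frac (y m) \<and> frac (y m) < \<gamma>} = {m \<in> M. frac (y m) < \<gamma>}"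
    "{m \<in> M. \<gamma> \<le> frac (y m) \<and> frac (y m) < 1} = {m \<in> M. \<gamma> \<le> frac (y m)}"
    by (auto simp: frac_lt_1)
  ultimately show ?thesis
    using upper lower unfolding W_def[symmetric] by (simp add: algebra_simps abs_le_iff)
qed

section \<open>Diophantine input\<close>

lemma dist_nearest_int_pos:
  assumes "\<alpha> \<notin> \<rat>" "q > 0"
  shows "0 < dist_nearest_int (\<alpha> * real q)"
proof (rule ccontr)
  assume "\<not> 0 < dist_nearest_int (\<alpha> * real q)"
  hence "\<alpha> * real q = of_int (round (\<alpha> * real q))"
    by (simp add: dist_nearest_int_def)
  hence "\<alpha> = of_int (round (\<alpha> * real q)) / of_nat q"
    using assms(2) by (simp add: field_simps)
  also have "\<dots> \<in> \<rat>" by (intro Rats_divide Rats_of_int Rats_of_nat)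
  finally show False using assms(1) by simp
qed

text \<open>An exponent above the supremum has nonzero liminf, which is then positive because the
  values are nonnegative. The finitely many q below the threshold go into the constant, each of them
  being positive by irrationality.\<close>

lemma diophantine_type_lower_bound:
  assumes irr: "\<alpha> \<notin> \<rat>" and type: "diophantine_type \<alpha> = ereal \<tau>" and \<theta>: "\<theta> > \<tau>"
  obtains c where "c > 0" "\<And>q. q > 0 \<Longrightarrow> c * real q powr (- \<theta>) \<le> dist_nearest_int (\<alpha> * real q)"
proof -
  define f where "f = (\<lambda>q::nat. real q powr \<theta> * dist_nearest_int (\<alpha> * real q))"
  have "liminf (\<lambda>q. ereal (f q)) \<noteq> 0"
  proof
    assume "liminf (\<lambda>q. ereal (f q)) = 0"
    hence "ereal \<theta> \<le> diophantine_type \<alpha>"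
      unfolding diophantine_type_def f_def by (intro Sup_upper) auto
    thus False using type \<theta> by simp
  qed
  moreover have "0 \<le> liminf (\<lambda>q. ereal (f q))"
    by (intro Liminf_bounded always_eventually) (simp add: f_def dist_nearest_int_nonneg)
  ultimately have "0 < liminf (\<lambda>q. ereal (f q))" by simp
  then obtain c where c: "0 < ereal c" "ereal c < liminf (\<lambda>q. ereal (f q))"
    using ereal_dense2 by blast
  from less_LiminfD[OF c(2)] obtain Q where Q: "\<And>q. q \<ge> Q \<Longrightarrow> c < f q"
    by (auto simp: eventually_sequentially)
  define c' where "c' = Min (insert c (f ` {1..<Q}))"
  have f_pos: "f q > 0" if "q > 0" for q
    using dist_nearest_int_pos[OF irr that] that by (simp add: f_def)
  have "c' > 0" using c(1) f_pos by (simp add: c'_def)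
  moreover have "c' * real q powr (- \<theta>) \<le> dist_nearest_int (\<alpha> * real q)" if q: "q > 0" for q
  proof -
    have "c' \<le> f q"
    proof (cases "q < Q")
      case True
      thus ?thesis using q unfolding c'_def by (intro Min_le) auto
    next
      case False
      have "c' \<le> c" unfolding c'_def by (intro Min_le) auto
      thus ?thesis using Q[of q] False by simp
    qed
    hence "c' * real q powr (- \<theta>) \<le> f q * real q powr (- \<theta>)" by (intro mult_right_mono) auto
    also have "\<dots> = dist_nearest_int (\<alpha> * real q)"
      using q by (simp add: f_def powr_minus field_simps)
    finally show ?thesis .
  qed
  ultimately show ?thesis by (rule that)
qed

text \<open>Dirichlet's theorem yields q \<le> N at distance below 1/N, against the lower bound c
  N^(-\<theta>) for some \<theta> < 1. The result later gives \<sigma> \<le> 1/4.\<close>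

lemma diophantine_type_ge_1:
  assumes irr: "\<alpha> \<notin> \<rat>" and type: "diophantine_type \<alpha> = ereal \<tau>"
  shows "\<tau> \<ge> 1"
proof (rule ccontr)
  assume "\<not> \<tau> \<ge> 1"
  \<comment> \<open>At this point \<tau> could be negative; the maximum keeps \<theta> positive, so
    that q^(-\<theta>) decreases.\<close>
  define \<theta> where "\<theta> = (max \<tau> 0 + 1) / 2"
  have \<theta>: "\<theta> > \<tau>" "0 < \<theta>" "\<theta> < 1" using \<open>\<not> \<tau> \<ge> 1\<close> by (auto simp: \<theta>_def)
  obtain c where c: "c > 0" "\<And>q. q > 0 \<Longrightarrow> c * real q powr (- \<theta>) \<le> dist_nearest_int (\<alpha> * real q)"
    using diophantine_type_lower_bound[OF irr type \<theta>(1)] by blast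
  have "eventually (\<lambda>N::nat. real N powr (1 - \<theta>) \<ge> 1 / c) sequentially"
  proof -
    have "filterlim (\<lambda>N::nat. real N powr (1 - \<theta>)) at_top sequentially"
      using \<theta> by real_asymp
    thus ?thesis by (simp add: filterlim_at_top)
  qed
  hence "eventually (\<lambda>N::nat. real N powr (1 - \<theta>) \<ge> 1 / c \<and> N > 0) sequentially"
    using eventually_gt_at_top[of 0] by (rule eventually_conj)
  then obtain N :: nat where N: "real N powr (1 - \<theta>) \<ge> 1 / c" "N > 0"
    by (auto simp: eventually_sequentially)
  obtain h k where hk: "0 < k" "k \<le> int N" "\<bar>of_int k * \<alpha> - of_int h\<bar> < 1 / real N"
    using Dirichlet_approx[OF N(2), of \<alpha>] by blast
  have "c * real N powr (- \<theta>) \<le> c * real (nat k) powr (- \<theta>)"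
    using c(1) hk \<theta> by (intro mult_left_mono powr_mono2') auto
  also have "\<dots> \<le> dist_nearest_int (\<alpha> * real (nat k))" using hk by (intro c) auto
  also have "\<dots> \<le> \<bar>\<alpha> * real (nat k) - of_int h\<bar>" by (rule dist_nearest_int_le)
  also have "\<dots> < 1 / real N" using hk by (simp add: mult.commute)
  finally have "c * real N powr (- \<theta>) * real N < 1" using N by (simp add: field_simps)
  also have "c * real N powr (- \<theta>) * real N = c * real N powr (1 - \<theta>)"
    using N by (simp add: powr_diff powr_minus field_simps)
  finally show False using N c by (simp add: field_simps)
qed

text \<open>If p is the integer nearest to q/\<alpha>, then |q/\<alpha> - p| = |\<alpha> p -
  q|/\<alpha>, and the right side is controlled by the hypothesis at p \<le> 2 q. The exponent is
  thus inherited by the inverse.\<close>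

lemma inverse_lower_bound:
  assumes \<alpha>: "\<alpha> > 1" and c: "c > 0" and \<theta>: "\<theta> > 0"
    and low: "\<And>q. q > 0 \<Longrightarrow> c * real q powr (- \<theta>) \<le> dist_nearest_int (\<alpha> * real q)"
  obtains c' where "0 < c'" "c' \<le> 1 / 2"
    "\<And>q. q > 0 \<Longrightarrow> c' * real q powr (- \<theta>) \<le> dist_nearest_int (inverse \<alpha> * real q)"
proof -
  \<comment> \<open>The entry 1/2 keeps later spacings at most 1/2, 1/\<alpha> serves the case p =
    0, where the distance is q/\<alpha>, and 2^(-\<theta>) pays for p \<le> 2 q.\<close>
  define c' where "c' = min (1 / 2) (min (inverse \<alpha>) (inverse \<alpha> * c * 2 powr (- \<theta>)))"
  have c': "0 < c'" "c' \<le> 1 / 2" "c' \<le> inverse \<alpha>" "c' \<le> inverse \<alpha> * c * 2 powr (- \<theta>)"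
    using \<alpha> c by (auto simp: c'_def)
  moreover have "c' * real q powr (- \<theta>) \<le> dist_nearest_int (inverse \<alpha> * real q)" if q: "q > 0" for q
  proof -
    define p where "p = round (inverse \<alpha> * real q)"
    have ia: "0 < inverse \<alpha>" "inverse \<alpha> < 1" using \<alpha> by (auto simp: field_simps)
    have D: "dist_nearest_int (inverse \<alpha> * real q) = \<bar>inverse \<alpha> * real q - of_int p\<bar>"
      by (simp add: dist_nearest_int_def p_def)
    show ?thesis
    proof (cases "p \<le> 0")
      case True
      have "real q powr (- \<theta>) \<le> 1" using q \<theta> by (simp add: powr_minus field_simps ge_one_powr_ge_zero)
      hence "c' * real q powr (- \<theta>) \<le> inverse \<alpha> * 1" using c' ia by (intro mult_mono) auto
      also have "\<dots> \<le> inverse \<alpha> * real q" using q ia by (intro mult_left_mono) auto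
      also have "\<dots> \<le> \<bar>inverse \<alpha> * real q - of_int p\<bar>" using True by simp
      finally show ?thesis by (simp add: D)
    next
      case False
      define n where "n = nat p"
      have n: "n > 0" "real n = of_int p" using False by (auto simp: n_def)
      have "of_int p \<le> inverse \<alpha> * real q + 1 / 2" unfolding p_def by (rule of_int_round_le)
      also have "inverse \<alpha> * real q \<le> 1 * real q" using ia by (intro mult_right_mono) auto
      finally have "real n \<le> 2 * real q" using q n by simp
      hence "(2 * real q) powr (- \<theta>) \<le> real n powr (- \<theta>)"
        using n \<theta> by (intro powr_mono2') auto
      have "c' * real q powr (- \<theta>) \<le> inverse \<alpha> * c * 2 powr (- \<theta>) * real q powr (- \<theta>)"
        using c' by (intro mult_right_mono) auto
      also have "\<dots> = inverse \<alpha> * (c * (2 * real q) powr (- \<theta>))"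
        by (simp add: powr_mult)
      also have "\<dots> \<le> inverse \<alpha> * (c * real n powr (- \<theta>))"
        using ia c \<open>(2 * real q) powr (- \<theta>) \<le> _\<close> by (intro mult_left_mono) auto
      also have "\<dots> \<le> inverse \<alpha> * dist_nearest_int (\<alpha> * real n)"
        using ia n by (intro mult_left_mono low) auto
      also have "\<dots> \<le> inverse \<alpha> * \<bar>\<alpha> * real n - of_int (int q)\<bar>"
        using ia by (intro mult_left_mono dist_nearest_int_le) auto
      also have "\<dots> = \<bar>inverse \<alpha> * (\<alpha> * real n - real q)\<bar>"
        using ia by (simp add: abs_mult)
      also have "inverse \<alpha> * (\<alpha> * real n - real q) = - (inverse \<alpha> * real q - of_int p)"
        using \<alpha> n by (simp add: field_simps)
      finally show ?thesis by (simp add: D)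
    qed
  qed
  ultimately show ?thesis using that by blast
qed

text \<open>The passage from n to m costs twice: X/d \<le> 2 M doubles the constant 8, and the term
  n = c, that is m = 0, is split off for ln X.\<close>

lemma expsum_progression_le:
  fixes d c k L M :: nat
  assumes cop: "coprime c d" and cd: "c < d" and L: "L > 0" and k: "1 \<le> k" "k \<le> H"
    and M: "M > 0"
    and \<theta>: "\<theta> > 0" and c0: "0 < c0" "c0 \<le> 1 / 2"
    and low: "\<And>q. q > 0 \<Longrightarrow> c0 * real q powr (- \<theta>) \<le> dist_nearest_int (\<gamma> * real q)"
    and size: "9 * (real d)\<^sup>2 * real L ^ 3 * ((real H * real L) powr \<theta> * (real H * real L * real d) powr \<theta>) / c0\<^sup>2 \<le> real M"
  shows "norm (\<Sum>m = 1..M. of_real (mangoldt (d * m + c)) * expi (real k * (\<gamma> * (\<beta> - real m))))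
    \<le> 16 * (1 + ln (real (d * M + c)))\<^sup>2 * real M / sqrt (real L) + ln (real (d * M + c))"
proof -
  define X where "X = d * M + c"
  \<comment> \<open>One step in m advances n by d, so d x has to be the phase -k \<gamma>; the type
    II phases are then multiples of k \<gamma> d.\<close>
  define x where "x = - (real k * \<gamma>) / real d"
  \<comment> \<open>The finite type bound is evaluated at the integers k j \<le> H L for type I and
    k j d \<le> H L d for type II.\<close>
  define \<delta>1 where "\<delta>1 = c0 * (real H * real L) powr (- \<theta>)"
  define \<delta>2 where "\<delta>2 = c0 * (real H * real L * real d) powr (- \<theta>)"
  have d: "d > 0" using cd by simp
  have H: "H > 0" using k by simp
  have HL: "real H * real L \<ge> 1" using H L mult_mono[of 1 "real H" 1 "real L"] by simp
  hence HLd: "real H * real L * real d \<ge> 1" using d mult_mono[of 1 "real H * real L" 1 "real d"] by simp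
  have X: "X > 0" using d M by (simp add: X_def)
  have dx: "real d * x = - (real k * \<gamma>)" using d by (simp add: x_def)
  have half: "c0 * u powr (- \<theta>) \<le> 1 / 2" if "u \<ge> 1" for u
  proof -
    have "u powr (- \<theta>) \<le> 1" using that \<theta> by (simp add: powr_minus field_simps ge_one_powr_ge_zero)
    hence "c0 * u powr (- \<theta>) \<le> 1 / 2 * 1" using c0 by (intro mult_mono) auto
    thus ?thesis by simp
  qed
  have \<delta>1: "0 < \<delta>1" "\<delta>1 \<le> 1 / 2" using half[OF HL] H L c0 by (auto simp: \<delta>1_def)
  have \<delta>2: "0 < \<delta>2" "\<delta>2 \<le> 1 / 2" using half[OF HLd] H L c0 d by (auto simp: \<delta>2_def)
  have low': "c0 * u powr (- \<theta>) \<le> dist_nearest_int (\<gamma> * real q)" if "q > 0" "real q \<le> u" for q u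
  proof -
    have "c0 * u powr (- \<theta>) \<le> c0 * real q powr (- \<theta>)"
      using that c0 \<theta> by (intro mult_left_mono powr_mono2') auto
    thus ?thesis using low[OF that(1)] by linarith
  qed
  have "norm (\<Sum>n = 1..X. of_real (mangoldt n) * prog_expi d c x n)
     \<le> 8 * (1 + ln (real X))\<^sup>2 * (real X / real d) / sqrt (real L)"
  proof (rule prime_expsum_le[OF cop d L \<delta>1 \<delta>2])
    fix j assume j: "1 \<le> j" "j \<le> L"
    have kj: "real k * real j \<le> real H * real L" using j k by (intro mult_mono) auto
    have "\<delta>1 \<le> dist_nearest_int (\<gamma> * real (k * j))"
      unfolding \<delta>1_def using j k kj by (intro low') auto
    also have "\<dots> = dist_nearest_int (- (\<gamma> * real (k * j)))" by simp
    also have "- (\<gamma> * real (k * j)) = real d * x * real j" unfolding dx by simp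
    finally show "\<delta>1 \<le> dist_nearest_int (real d * x * real j)" .
    have "\<delta>2 \<le> dist_nearest_int (\<gamma> * real (k * j * d))"
      unfolding \<delta>2_def using j k d kj by (intro low') (auto intro!: mult_right_mono)
    also have "\<dots> = dist_nearest_int (- (\<gamma> * real (k * j * d)))" by simp
    also have "- (\<gamma> * real (k * j * d)) = real d * (real d * x) * real j" unfolding dx by simp
    finally show "\<delta>2 \<le> dist_nearest_int (real d * (real d * x) * real j)" .
  next
    have "\<delta>1 * \<delta>2 = c0\<^sup>2 / ((real H * real L) powr \<theta> * (real H * real L * real d) powr \<theta>)"
      by (simp add: \<delta>1_def \<delta>2_def powr_minus power2_eq_square field_simps)
    hence "9 * (real d)\<^sup>2 * real L ^ 3 / (\<delta>1 * \<delta>2) \<le> real M" using size by simp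
    also have "\<dots> \<le> real X / real d" using d by (simp add: X_def field_simps)
    finally show "9 * (real d)\<^sup>2 * real L ^ 3 / (\<delta>1 * \<delta>2) \<le> real X / real d" .
  qed
  also have "8 * (1 + ln (real X))\<^sup>2 * (real X / real d) / sqrt (real L) \<le> 8 * (1 + ln (real X))\<^sup>2 * (2 * real M) / sqrt (real L)"
  proof (intro divide_right_mono mult_left_mono)
    have "X \<le> d * (2 * M)"
    proof -
      have "c \<le> d * M" using cd M by (metis le_trans less_imp_le_nat mult.right_neutral mult_le_mono2 Suc_leI One_nat_def)
      moreover have "d * (2 * M) = d * M + d * M" by simp
      ultimately show ?thesis unfolding X_def by linarith
    qed
    hence "real X \<le> real d * (2 * real M)" by (metis of_nat_le_iff of_nat_mult of_nat_numeral)
    thus "real X / real d \<le> 2 * real M" using d by (simp add: field_simps)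
  qed auto
  finally have main: "norm (\<Sum>n = 1..X. of_real (mangoldt n) * prog_expi d c x n)
     \<le> 16 * (1 + ln (real X))\<^sup>2 * real M / sqrt (real L)" by simp
  have inj: "inj_on (\<lambda>m. d * m + c) A" for A using d by (auto intro!: inj_onI)
  \<comment> \<open>The index sets differ only where the summand vanishes: outside the residue
    class, and at n = 0, which occurs for c = 0 and where \<open>mangoldt 0 = 0\<close>.\<close>
  have "(\<Sum>n = 1..X. of_real (mangoldt n) * prog_expi d c x n) = (\<Sum>n \<in> (\<lambda>m. d * m + c) ` {0..M}. of_real (mangoldt n) * prog_expi d c x n)"
  proof (rule sum.mono_neutral_cong)
    fix n assume n: "n \<in> {1..X} - (\<lambda>m. d * m + c) ` {0..M}"
    have "\<not> [n = c] (mod d)"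
    proof
      assume "[n = c] (mod d)"
      hence "n mod d = c" using cd by (simp add: cong_def)
      hence e: "n = d * (n div d) + c" by (metis mult_div_mod_eq)
      have "d * (n div d) + c \<le> d * M + c" using n e by (simp add: X_def)
      hence "n div d \<le> M" using d by simp
      hence "n \<in> (\<lambda>m. d * m + c) ` {0..M}" by (subst e, intro image_eqI[where x = "n div d"]) auto
      with n show False by simp
    qed
    thus "of_real (mangoldt n) * prog_expi d c x n = 0" by (simp add: prog_expi_def)
  next
    fix n assume "n \<in> (\<lambda>m. d * m + c) ` {0..M} - {1..X}"
    then obtain m where m: "n = d * m + c" "m \<in> {0..M}" "n \<notin> {1..X}" by blast
    hence "n \<le> X" by (simp add: X_def)
    hence "n = 0" using m(3) by simp
    thus "of_real (mangoldt n) * prog_expi d c x n = 0" by simp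
  qed auto
  also have "\<dots> = (\<Sum>m = 0..M. of_real (mangoldt (d * m + c)) * prog_expi d c x (d * m + c))"
    by (subst sum.reindex[OF inj]) simp
  also have "\<dots> = of_real (mangoldt c) * prog_expi d c x c + (\<Sum>m = 1..M. of_real (mangoldt (d * m + c)) * prog_expi d c x (d * m + c))"
    by (simp add: sum.atLeast_Suc_atMost)
  also have "(\<Sum>m = 1..M. of_real (mangoldt (d * m + c)) * prog_expi d c x (d * m + c))
     = expi (x * real c - real k * (\<gamma> * \<beta>)) * (\<Sum>m = 1..M. of_real (mangoldt (d * m + c)) * expi (real k * (\<gamma> * (\<beta> - real m))))"
    unfolding sum_distrib_left
  proof (rule sum.cong[OF refl])
    fix m
    have "x * real (d * m + c) = (real d * x) * real m + x * real c" by (simp add: algebra_simps)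
    also have "\<dots> = (x * real c - real k * (\<gamma> * \<beta>)) + real k * (\<gamma> * (\<beta> - real m))"
      unfolding dx by (simp add: algebra_simps)
    finally have "x * real (d * m + c) = (x * real c - real k * (\<gamma> * \<beta>)) + real k * (\<gamma> * (\<beta> - real m))" .
    hence "expi (x * real (d * m + c)) = expi (x * real c - real k * (\<gamma> * \<beta>)) * expi (real k * (\<gamma> * (\<beta> - real m)))"
      by (simp only: cis_mult distrib_left)
    moreover have "[d * m + c = c] (mod d)" by (simp add: cong_def)
    ultimately show "of_real (mangoldt (d * m + c)) * prog_expi d c x (d * m + c) =
        expi (x * real c - real k * (\<gamma> * \<beta>)) * (of_real (mangoldt (d * m + c)) * expi (real k * (\<gamma> * (\<beta> - real m))))"
      unfolding prog_expi_def by simp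
  qed
  finally have eq: "(\<Sum>n = 1..X. of_real (mangoldt n) * prog_expi d c x n) = of_real (mangoldt c) * prog_expi d c x c + \<dots>" .
  define T where "T = (\<Sum>m = 1..M. of_real (mangoldt (d * m + c)) * expi (real k * (\<gamma> * (\<beta> - real m))))"
  have "norm T = norm (expi (x * real c - real k * (\<gamma> * \<beta>)) * T)" by (simp add: norm_mult)
  also have "\<dots> = norm ((\<Sum>n = 1..X. of_real (mangoldt n) * prog_expi d c x n) - of_real (mangoldt c) * prog_expi d c x c)"
    unfolding eq T_def by simp
  also have "\<dots> \<le> norm (\<Sum>n = 1..X. of_real (mangoldt n) * prog_expi d c x n) + norm (of_real (mangoldt c) * prog_expi d c x c)"
    by (rule norm_triangle_ineq4)
  also have "norm (of_real (mangoldt c) * prog_expi d c x c) \<le> ln (real X)"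
  proof (cases "c = 0")
    case True
    thus ?thesis using X by (simp add: ln_ge_zero)
  next
    case False
    have "mangoldt c * norm (prog_expi d c x c) \<le> mangoldt c * 1"
      by (intro mult_left_mono norm_prog_expi_le_1 mangoldt_nonneg)
    also have "\<dots> \<le> ln (real c)" using mangoldt_le[of c] False by simp
    also have "\<dots> \<le> ln (real X)"
      using False X by (subst ln_le_cancel_iff) (simp_all only: of_nat_le_iff of_nat_0_less_iff, simp_all add: X_def)
    finally show ?thesis by (simp add: norm_mult)
  qed
  finally show ?thesis using main unfolding T_def X_def by linarith
qed

section \<open>Beatty sequences\<close>

text \<open>Dividing m \<le> \<alpha> n + \<beta> < m + 1 by \<alpha> places n + (\<beta> -
  m)/\<alpha> in [0, 1/\<alpha>), a part of [0, 1), so n must be minus the floor of (\<beta> -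
  m)/\<alpha>. Here n is an arbitrary integer; its range is restored in
  \<open>beatty_sum_diff_le\<close>.\<close>

lemma beatty_value_iff:
  fixes \<alpha> \<beta> :: real and m :: int
  assumes \<alpha>: "\<alpha> > 1"
  shows "frac (inverse \<alpha> * (\<beta> - of_int m)) < inverse \<alpha> \<longleftrightarrow> (\<exists>n::int. \<lfloor>\<alpha> * of_int n + \<beta>\<rfloor> = m)"
proof -
  define y where "y = inverse \<alpha> * (\<beta> - of_int m)"
  have ia: "inverse \<alpha> < 1" using \<alpha> by (simp add: field_simps)
  have iff: "\<lfloor>\<alpha> * of_int n + \<beta>\<rfloor> = m \<longleftrightarrow> 0 \<le> y + of_int n \<and> y + of_int n < inverse \<alpha>" for n :: int
  proof -
    define z where "z = \<alpha> * of_int n + \<beta> - of_int m"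
    have "y + of_int n = z / \<alpha>" using \<alpha> by (simp add: y_def z_def field_simps)
    moreover have "0 \<le> z / \<alpha> \<longleftrightarrow> 0 \<le> z" "z / \<alpha> < inverse \<alpha> \<longleftrightarrow> z < 1"
      using \<alpha> by (auto simp: zero_le_divide_iff inverse_eq_divide divide_less_cancel)
    ultimately show ?thesis unfolding floor_eq_iff z_def by auto
  qed
  show ?thesis
  proof
    assume "frac (inverse \<alpha> * (\<beta> - of_int m)) < inverse \<alpha>"
    hence "0 \<le> y + of_int (- \<lfloor>y\<rfloor>) \<and> y + of_int (- \<lfloor>y\<rfloor>) < inverse \<alpha>"
      using frac_ge_0[of y] by (simp add: y_def[symmetric] frac_def)
    thus "\<exists>n::int. \<lfloor>\<alpha> * of_int n + \<beta>\<rfloor> = m" using iff by blast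
  next
    assume "\<exists>n::int. \<lfloor>\<alpha> * of_int n + \<beta>\<rfloor> = m"
    then obtain n :: int where n: "0 \<le> y + of_int n" "y + of_int n < inverse \<alpha>" using iff by blast
    hence "frac y = y + of_int n" using ia by (subst frac_unique_iff) auto
    thus "frac (inverse \<alpha> * (\<beta> - of_int m)) < inverse \<alpha>" using n by (simp add: y_def)
  qed
qed

lemma floor_linear_less:
  fixes \<alpha> \<beta> :: real and n n' :: int
  assumes "\<alpha> > 1" "n < n'"
  shows "\<lfloor>\<alpha> * of_int n + \<beta>\<rfloor> < \<lfloor>\<alpha> * of_int n' + \<beta>\<rfloor>"
proof -
  have "\<alpha> * of_int n + \<alpha> * 1 \<le> \<alpha> * of_int n'"
    unfolding distrib_left[symmetric] using assms by (intro mult_left_mono) linarith+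
  hence "\<alpha> * of_int n + \<beta> + 1 \<le> \<alpha> * of_int n' + \<beta>" using assms(1) by linarith
  thus ?thesis by linarith
qed

lemma mangoldt_int_nonneg: "mangoldt_int m \<ge> 0"
  by (simp add: mangoldt_int_def mangoldt_nonneg)

text \<open>The sums agree on the n in {1..N} whose floor is at least 1. Negative floors contribute
  0, since c < d makes the argument of \<Lambda> negative. The floor 0 occurs at most once by
  injectivity. The values m \<ge> 1 attained only at some n \<le> 0 satisfy m \<le> |\<beta>|. This
  explains the factor |\<beta>| + 1.\<close>

lemma beatty_sum_diff_le:
  fixes d c N :: nat and \<alpha> \<beta> l :: real
  assumes \<alpha>: "\<alpha> > 1" and cd: "c < d"
  defines "M \<equiv> \<lfloor>\<alpha> * real N + \<beta>\<rfloor>" and "g \<equiv> \<lambda>m. mangoldt_int (int d * m + int c)"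
  assumes l: "l \<ge> 0" "\<And>m. 0 \<le> m \<Longrightarrow> m \<le> M \<Longrightarrow> g m \<le> l" and M: "M \<ge> 0"
  shows "\<bar>(\<Sum>n = 1..N. g \<lfloor>\<alpha> * real n + \<beta>\<rfloor>)
      - (\<Sum>m | m \<in> {1..M} \<and> frac (inverse \<alpha> * (\<beta> - of_int m)) < inverse \<alpha>. g m)\<bar> \<le> (\<bar>\<beta>\<bar> + 1) * l"
proof -
  define a where "a = (\<lambda>n::nat. \<lfloor>\<alpha> * real n + \<beta>\<rfloor>)"
  define P where "P = {n \<in> {1..N}. a n \<ge> 1}"
  define B where "B = {m \<in> {1..M}. frac (inverse \<alpha> * (\<beta> - of_int m)) < inverse \<alpha>}"
  have g0: "g m \<ge> 0" for m by (simp add: g_def mangoldt_int_nonneg)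
  have g_neg: "g m = 0" if "m < 0" for m
  proof -
    have "int d * m \<le> int d * (-1)" using that by (intro mult_left_mono) auto
    hence "int d * m + int c < 0" using cd by linarith
    thus ?thesis by (simp add: g_def mangoldt_int_def)
  qed
  have a_less: "a n < a n'" if "n < n'" for n n'
    using floor_linear_less[OF \<alpha>, of "int n" "int n'" \<beta>] that by (simp add: a_def)
  have inj: "inj a" using a_less by (metis injI less_irrefl linorder_neqE_nat)
  have aM: "a n \<le> M" if "n \<le> N" for n
    using a_less[of n N] that by (cases "n = N") (auto simp: M_def a_def)
  have sub: "a ` P \<subseteq> B"
  proof
    fix m assume "m \<in> a ` P"
    then obtain n where n: "m = a n" "n \<in> {1..N}" "a n \<ge> 1" by (auto simp: P_def)
    have "\<lfloor>\<alpha> * of_int (int n) + \<beta>\<rfloor> = m" using n by (simp add: a_def)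
    hence "frac (inverse \<alpha> * (\<beta> - of_int m)) < inverse \<alpha>" using beatty_value_iff[OF \<alpha>] by blast
    thus "m \<in> B" using n aM[of n] by (simp add: B_def)
  qed
  have finB: "finite B" by (rule finite_subset[of _ "{1..M}"]) (auto simp: B_def)
  have rest: "B - a ` P \<subseteq> {1..\<lfloor>\<bar>\<beta>\<bar>\<rfloor>}"
  proof
    fix m assume m: "m \<in> B - a ` P"
    hence m1: "1 \<le> m" "m \<le> M" by (auto simp: B_def)
    obtain n :: int where n: "\<lfloor>\<alpha> * of_int n + \<beta>\<rfloor> = m"
      using m beatty_value_iff[OF \<alpha>, of \<beta> m] unfolding B_def by blast
    have "\<not> int N < n" using floor_linear_less[OF \<alpha>, of "int N" n \<beta>] n m1 by (auto simp: M_def)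
    have "n \<le> 0"
    proof (rule ccontr)
      assume "\<not> n \<le> 0"
      hence "m = a (nat n)" "nat n \<in> P" using n m1 \<open>\<not> int N < n\<close> by (auto simp: a_def P_def)
      thus False using m by blast
    qed
    hence "\<alpha> * of_int n \<le> 0" using \<alpha> by (simp add: mult_nonneg_nonpos)
    hence "m \<le> \<lfloor>\<bar>\<beta>\<bar>\<rfloor>" unfolding n[symmetric] by (intro floor_mono) linarith
    thus "m \<in> {1..\<lfloor>\<bar>\<beta>\<bar>\<rfloor>}" using m1 by simp
  qed
  have "(\<Sum>n = 1..N. g (a n)) = (\<Sum>n\<in>P. g (a n)) + (\<Sum>n\<in>{1..N} - P. g (a n))"
    by (subst sum.subset_diff[of P]) (auto simp: P_def)
  also have "(\<Sum>n\<in>P. g (a n)) = (\<Sum>m\<in>a ` P. g m)"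
    using inj by (subst sum.reindex) (auto intro: inj_on_subset)
  finally have 1: "(\<Sum>n = 1..N. g (a n)) = (\<Sum>m\<in>a ` P. g m) + (\<Sum>n\<in>{1..N} - P. g (a n))" .
  have 2: "(\<Sum>m\<in>B. g m) = (\<Sum>m\<in>a ` P. g m) + (\<Sum>m\<in>B - a ` P. g m)"
    using sum.subset_diff[OF sub finB, of g] by simp
  have 3: "(\<Sum>n\<in>{1..N} - P. g (a n)) \<le> 1 * l"
  proof -
    have "(\<Sum>n\<in>{1..N} - P. g (a n)) = (\<Sum>n\<in>{n \<in> {1..N} - P. a n = 0}. g (a n))"
      by (rule sum.mono_neutral_right) (auto simp: P_def intro!: g_neg)
    also have "\<dots> \<le> real (card {n \<in> {1..N} - P. a n = 0}) * l"
      using l M by (intro sum_bounded_above) auto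
    also have "\<dots> \<le> 1 * l"
    proof (intro mult_right_mono l)
      have "card {n \<in> {1..N} - P. a n = 0} \<le> Suc 0"
        by (subst card_le_Suc0_iff_eq) (use inj in \<open>auto, metis injD\<close>)
      thus "real (card {n \<in> {1..N} - P. a n = 0}) \<le> 1" by simp
    qed
    finally show ?thesis .
  qed
  have 4: "(\<Sum>m\<in>B - a ` P. g m) \<le> \<bar>\<beta>\<bar> * l"
  proof -
    have "(\<Sum>m\<in>B - a ` P. g m) \<le> real (card (B - a ` P)) * l"
      by (intro sum_bounded_above l) (auto simp: B_def)
    also have "\<dots> \<le> \<bar>\<beta>\<bar> * l"
    proof (intro mult_right_mono l)
      have "card (B - a ` P) \<le> card {1..\<lfloor>\<bar>\<beta>\<bar>\<rfloor>}" using rest by (intro card_mono) auto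
      also have "\<dots> = nat \<lfloor>\<bar>\<beta>\<bar>\<rfloor>" by simp
      finally have "real (card (B - a ` P)) \<le> real (nat \<lfloor>\<bar>\<beta>\<bar>\<rfloor>)" by (simp only: of_nat_le_iff)
      also have "\<dots> \<le> \<bar>\<beta>\<bar>" by simp
      finally show "real (card (B - a ` P)) \<le> \<bar>\<beta>\<bar>" .
    qed
    finally show ?thesis .
  qed
  have 5: "0 \<le> (\<Sum>n\<in>{1..N} - P. g (a n))" "0 \<le> (\<Sum>m\<in>B - a ` P. g m)"
    by (auto intro!: sum_nonneg g0)
  have "\<bar>(\<Sum>n = 1..N. g (a n)) - (\<Sum>m\<in>B. g m)\<bar> \<le> \<bar>\<beta>\<bar> * l + 1 * l"
    unfolding 1 2 using 3 4 5 l by (simp add: abs_le_iff)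
  thus ?thesis unfolding a_def B_def by (simp add: distrib_right)
qed

text \<open>The terms of the bound are, in order, the ends of the Beatty range, the resolution 1/h
  with the total weight estimated by M l, and h^3 times the exponential sum bound. The discrepancy
  inequality uses frequencies k < h^3, hence \<open>h ^ 3\<close> in \<open>size\<close>.\<close>

lemma beatty_progression_le:
  fixes d c N L h M :: nat and \<alpha> \<beta> \<theta> c0 :: real
  assumes \<alpha>: "\<alpha> > 1" and cop: "coprime c d" and cd: "c < d" and L: "L > 0" and h: "h > 0"
    and M: "M > 0" "int M = \<lfloor>\<alpha> * real N + \<beta>\<rfloor>"
    and \<theta>: "\<theta> > 0" and c0: "0 < c0" "c0 \<le> 1 / 2"
    and low: "\<And>q. q > 0 \<Longrightarrow> c0 * real q powr (- \<theta>) \<le> dist_nearest_int (inverse \<alpha> * real q)"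
    and size: "9 * (real d)\<^sup>2 * real L ^ 3 * ((real (h ^ 3) * real L) powr \<theta> * (real (h ^ 3) * real L * real d) powr \<theta>) / c0\<^sup>2 \<le> real M"
  defines "l \<equiv> ln (real (d * M + c))"
  shows "\<bar>(\<Sum>n = 1..N. mangoldt_int (int d * \<lfloor>\<alpha> * real n + \<beta>\<rfloor> + int c))
         - inverse \<alpha> * (\<Sum>m = 1..\<lfloor>\<alpha> * real N + \<beta>\<rfloor>. mangoldt_int (int d * m + int c))\<bar>
       \<le> (\<bar>\<beta>\<bar> + 1) * l + 8 * (real M * l) / real h + real h ^ 3 * (16 * (1 + l)\<^sup>2 * real M / sqrt (real L) + l)"
proof -
  define \<gamma> where "\<gamma> = inverse \<alpha>"
  define g where "g = (\<lambda>m. mangoldt_int (int d * m + int c))"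
  define w where "w = (\<lambda>m::nat. mangoldt (d * m + c) :: real)"
  have \<gamma>: "0 \<le> \<gamma>" "\<gamma> \<le> 1" using \<alpha> by (auto simp: \<gamma>_def field_simps)
  have d: "d > 0" using cd by simp
  have X1: "d * M + c \<ge> 1" using d M by (simp add: Suc_le_eq)
  have l: "l \<ge> 0" unfolding l_def using X1 by (intro ln_ge_zero) (simp del: of_nat_mult of_nat_add)
  have gw: "g (int m) = w m" for m
  proof -
    have "int d * int m + int c = int (d * m + c)" by simp
    thus ?thesis unfolding g_def w_def mangoldt_int_def by (simp only: nat_int)
  qed
  have w_le: "w m \<le> l" if "m \<le> M" for m
  proof (cases "d * m + c = 0")
    case True
    thus ?thesis using l unfolding w_def by (simp only: mangoldt_0)
  next
    case False
    hence "w m \<le> ln (real (d * m + c))" unfolding w_def by (intro mangoldt_le) simp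
    also have "\<dots> \<le> l"
      unfolding l_def using False that X1 by (subst ln_le_cancel_iff) (auto simp del: of_nat_mult of_nat_add)
    finally show ?thesis .
  qed
  have g_le: "g m \<le> l" if m: "0 \<le> m" "m \<le> int M" for m
    using w_le[of "nat m"] gw[of "nat m"] m by simp
  have M0: "\<lfloor>\<alpha> * real N + \<beta>\<rfloor> \<ge> 0" using M by linarith
  have D1: "\<bar>(\<Sum>n = 1..N. g \<lfloor>\<alpha> * real n + \<beta>\<rfloor>)
      - (\<Sum>m | m \<in> {1..int M} \<and> frac (\<gamma> * (\<beta> - of_int m)) < \<gamma>. g m)\<bar> \<le> (\<bar>\<beta>\<bar> + 1) * l"
    unfolding M(2) \<gamma>_def g_def
    by (rule beatty_sum_diff_le[OF \<alpha> cd l _ M0]) (use g_le M in \<open>simp add: g_def\<close>)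
  have S: "norm (\<Sum>m = 1..M. of_real (w m) * expi (real k * (\<gamma> * (\<beta> - real m)))) \<le> 16 * (1 + l)\<^sup>2 * real M / sqrt (real L) + l"
    if k: "1 \<le> k" "k < h ^ 3" for k
    using expsum_progression_le[OF cop cd L k(1) less_imp_le[OF k(2)] M(1) \<theta> c0 low size, of \<beta>]
    unfolding w_def l_def \<gamma>_def by (simp del: of_nat_mult of_nat_add)
  have D2: "\<bar>(\<Sum>m | m \<in> {1..M} \<and> frac (\<gamma> * (\<beta> - real m)) < \<gamma>. w m) - \<gamma> * (\<Sum>m = 1..M. w m)\<bar>
     \<le> 8 * (\<Sum>m = 1..M. w m) / real h + real h ^ 3 * (16 * (1 + l)\<^sup>2 * real M / sqrt (real L) + l)"
    by (rule weighted_discrepancy) (use S h \<gamma> l in \<open>auto simp: w_def mangoldt_nonneg\<close>)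
  have W: "(\<Sum>m = 1..M. w m) \<le> real M * l"
    using sum_bounded_above[of "{1..M}" w l] w_le by simp
  have c1: "(\<Sum>m | m \<in> {1..int M} \<and> frac (\<gamma> * (\<beta> - of_int m)) < \<gamma>. g m) = (\<Sum>m | m \<in> {1..M} \<and> frac (\<gamma> * (\<beta> - real m)) < \<gamma>. w m)"
    by (rule sum.reindex_bij_witness[of _ int nat]) (auto simp: gw[symmetric])
  have c2: "(\<Sum>m = 1..int M. g m) = (\<Sum>m = 1..M. w m)"
    by (rule sum.reindex_bij_witness[of _ int nat]) (auto simp: gw[symmetric])
  have "8 * (\<Sum>m = 1..M. w m) / real h \<le> 8 * (real M * l) / real h"
    using W by (intro divide_right_mono) auto
  hence "\<bar>(\<Sum>n = 1..N. g \<lfloor>\<alpha> * real n + \<beta>\<rfloor>) - \<gamma> * (\<Sum>m = 1..int M. g m)\<bar>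
    \<le> (\<bar>\<beta>\<bar> + 1) * l + 8 * (real M * l) / real h + real h ^ 3 * (16 * (1 + l)\<^sup>2 * real M / sqrt (real L) + l)"
    using D1 D2 unfolding c1 c2 by linarith
  thus ?thesis unfolding M(2) g_def \<gamma>_def .
qed

section \<open>Choice of parameters\<close>

lemma nat_ceiling_bounds:
  fixes x :: real
  assumes "x \<ge> 1"
  shows "x \<le> real (nat \<lceil>x\<rceil>)" "real (nat \<lceil>x\<rceil>) \<le> 2 * x" "nat \<lceil>x\<rceil> > 0"
proof -
  have "real (nat \<lceil>x\<rceil>) = of_int \<lceil>x\<rceil>" using assms by (intro of_nat_nat) linarith
  thus "x \<le> real (nat \<lceil>x\<rceil>)" "real (nat \<lceil>x\<rceil>) \<le> 2 * x" "nat \<lceil>x\<rceil> > 0"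
    using assms of_int_ceiling_le_add_one[of x] le_of_int_ceiling[of x] by linarith+
qed

text \<open>Each error term of the final estimate gets a quarter of N^(1-\<eta>). The expression ln
  (2 A) + 2 ln N dominates the logarithm of the largest argument d M + c.\<close>

lemma eventually_error_terms:
  fixes A B \<eta> :: real
  assumes \<eta>: "0 < \<eta>" "\<eta> < 1 / 100" and A: "A > 0" and B: "B > 0"
  shows "eventually (\<lambda>N::nat. B * (ln (2 * A) + 2 * ln (real N)) \<le> real N powr (1 - \<eta>) / 4) sequentially"
    and "eventually (\<lambda>N::nat. 8 * A * (ln (2 * A) + 2 * ln (real N)) * real N powr (1 - 2 * \<eta>) \<le> real N powr (1 - \<eta>) / 4) sequentially"
    and "eventually (\<lambda>N::nat. 128 * A * (1 + (ln (2 * A) + 2 * ln (real N)))\<^sup>2 * real N powr (1 - 4 * \<eta>) \<le> real N powr (1 - \<eta>) / 4) sequentially"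
    and "eventually (\<lambda>N::nat. 8 * real N powr (6 * \<eta>) * (ln (2 * A) + 2 * ln (real N)) \<le> real N powr (1 - \<eta>) / 4) sequentially"
proof -
  have \<eta>': "1 - \<eta> > 0" "1 - 2 * \<eta> < 1 - \<eta>" "1 - 4 * \<eta> < 1 - \<eta>" "6 * \<eta> < 1 - \<eta>" using \<eta> by auto
  show "eventually (\<lambda>N::nat. B * (ln (2 * A) + 2 * ln (real N)) \<le> real N powr (1 - \<eta>) / 4) sequentially"
    using A B \<eta> \<eta>' by real_asymp
  show "eventually (\<lambda>N::nat. 8 * A * (ln (2 * A) + 2 * ln (real N)) * real N powr (1 - 2 * \<eta>) \<le> real N powr (1 - \<eta>) / 4) sequentially"
    using A B \<eta> \<eta>' by real_asymp
  show "eventually (\<lambda>N::nat. 128 * A * (1 + (ln (2 * A) + 2 * ln (real N)))\<^sup>2 * real N powr (1 - 4 * \<eta>) \<le> real N powr (1 - \<eta>) / 4) sequentially"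
    using A B \<eta> \<eta>' by real_asymp
  show "eventually (\<lambda>N::nat. 8 * real N powr (6 * \<eta>) * (ln (2 * A) + 2 * ln (real N)) \<le> real N powr (1 - \<eta>) / 4) sequentially"
    using A B \<eta> \<eta>' by real_asymp
qed


theorem theorem2:
  fixes \<alpha> \<beta> \<tau> :: real
  assumes "\<alpha> > 1" and "\<alpha> \<notin> \<rat>" and "diophantine_type \<alpha> = ereal \<tau>"
  shows "\<exists>\<epsilon>>0. \<epsilon> < 1 / (2 * \<tau> + 2) \<and>
    (\<exists>K>0. \<forall>C>0. \<exists>N\<^sub>0::nat. \<forall>N\<ge>N\<^sub>0. \<forall>c d :: int.
       0 \<le> c \<and> c < d \<and> real_of_int d \<le> C * real N powr (1 / (2 * \<tau> + 2) - \<epsilon>) \<and> gcd c d = 1 \<longrightarrow>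
       \<bar>(\<Sum>n = 1..N. mangoldt_int (d * \<lfloor>\<alpha> * real n + \<beta>\<rfloor> + c))
         - inverse \<alpha> * (\<Sum>m = 1..\<lfloor>\<alpha> * real N + \<beta>\<rfloor>. mangoldt_int (d * m + c))\<bar>
       \<le> K * real N powr (1 - \<epsilon>))"
proof -
  have \<tau>: "\<tau> \<ge> 1" by (rule diophantine_type_ge_1[OF assms(2,3)])
  define \<sigma> where "\<sigma> = 1 / (2 * \<tau> + 2)"
  \<comment> \<open>This becomes \<epsilon>. The factor \<tau> + 2 bounds \<eta> \<theta> by 1/400
    for every \<tau>, and 400 makes 61 \<eta> + 52 \<eta> \<theta> smaller than the available
    1/4.\<close>
  define \<eta> where "\<eta> = 1 / (400 * (\<tau> + 2))"
  define \<theta> where "\<theta> = \<tau> + \<eta>"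
  define A where "A = \<alpha> + \<bar>\<beta>\<bar> + 1"
  have \<eta>: "0 < \<eta>" "\<eta> < 1 / 100" "\<eta> < \<sigma>" "\<eta> * (\<tau> + 2) = 1 / 400"
    using \<tau> by (auto simp: \<eta>_def \<sigma>_def field_simps)
  have \<sigma>: "0 < \<sigma>" "\<sigma> \<le> 1 / 4" "\<sigma> * (2 * \<tau> + 2) = 1"
    using \<tau> by (auto simp: \<sigma>_def field_simps)
  have \<theta>: "\<theta> > \<tau>" "\<theta> > 0" using \<eta> \<tau> by (auto simp: \<theta>_def)
  have A: "A > 0" using assms(1) by (simp add: A_def)
  obtain c1 where c1: "c1 > 0" "\<And>q. q > 0 \<Longrightarrow> c1 * real q powr (- \<theta>) \<le> dist_nearest_int (\<alpha> * real q)"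
    using diophantine_type_lower_bound[OF assms(2,3) \<theta>(1)] by blast
  obtain c0 where c0: "0 < c0" "c0 \<le> 1 / 2"
    "\<And>q. q > 0 \<Longrightarrow> c0 * real q powr (- \<theta>) \<le> dist_nearest_int (inverse \<alpha> * real q)"
    using inverse_lower_bound[OF assms(1) c1(1) \<theta>(2) c1(2)] by blast
  \<comment> \<open>Constant and exponent of the size condition at d = N^\<sigma>: d^2 gives
    2\<sigma>, L^3 gives 60\<eta>, the two powers of h^3 L give 26\<eta>\<theta> each, and
    d^\<theta> gives \<sigma>\<theta>. The constant collects the roundings in h and L.\<close>
  define K1 where "K1 = 72 * (16 powr \<theta> * 16 powr \<theta>) / c0\<^sup>2"
  define e where "e = 2 * \<sigma> + 60 * \<eta> + 52 * \<eta> * \<theta> + \<sigma> * \<theta>"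
  have K1: "K1 > 0" using c0 by (simp add: K1_def)
  have e: "e < 1"
  proof -
    have "\<sigma> * \<tau> = 1 / 2 - \<sigma>" using \<sigma>(3) by (simp add: algebra_simps)
    hence "2 * \<sigma> + \<sigma> * \<theta> = 1 / 2 + \<sigma> + \<sigma> * \<eta>" by (simp add: \<theta>_def algebra_simps)
    also have "\<sigma> * \<eta> \<le> 1 * \<eta>" using \<sigma> \<eta> by (intro mult_right_mono) auto
    finally have 1: "2 * \<sigma> + \<sigma> * \<theta> \<le> 3 / 4 + \<eta>" using \<sigma> by linarith
    have "\<eta> * \<theta> \<le> \<eta> * (\<tau> + 2)" using \<eta> by (intro mult_left_mono) (auto simp: \<theta>_def)
    hence 2: "\<eta> * \<theta> \<le> 1 / 400" using \<eta>(4) by simp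
    have "\<eta> * 3 \<le> \<eta> * (\<tau> + 2)" using \<tau> \<eta> by (intro mult_left_mono) auto
    hence 3: "\<eta> \<le> 1 / 1200" using \<eta>(4) by simp
    have "52 * \<eta> * \<theta> = 52 * (\<eta> * \<theta>)" by simp
    thus ?thesis unfolding e_def using 1 2 3 by linarith
  qed
  define ell where "ell = (\<lambda>N::nat. ln (2 * A) + 2 * ln (real N))"
  have ev_size: "eventually (\<lambda>N::nat. K1 * real N powr e \<le> real N) sequentially"
    using K1 e by real_asymp
  have B: "\<bar>\<beta>\<bar> + 1 > 0" by simp
  note ev_err = eventually_error_terms[OF \<eta>(1,2) A B]
  have ev_M: "eventually (\<lambda>N::nat. \<alpha> * real N + \<beta> - 1 \<ge> real N) sequentially"
    using assms(1) by real_asymp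
  have main: "\<exists>N\<^sub>0::nat. \<forall>N\<ge>N\<^sub>0. \<forall>c d :: int.
       0 \<le> c \<and> c < d \<and> real_of_int d \<le> C * real N powr (\<sigma> - \<eta>) \<and> gcd c d = 1 \<longrightarrow>
       \<bar>(\<Sum>n = 1..N. mangoldt_int (d * \<lfloor>\<alpha> * real n + \<beta>\<rfloor> + c))
         - inverse \<alpha> * (\<Sum>m = 1..\<lfloor>\<alpha> * real N + \<beta>\<rfloor>. mangoldt_int (d * m + c))\<bar>
       \<le> 1 * real N powr (1 - \<eta>)" if C: "C > 0" for C :: real
  proof -
    \<comment> \<open>The estimate holds for all d \<le> N^\<sigma>, so the factor N^(-\<eta>) in
      the range of d only has to absorb C. The threshold depends on C, the constant 1 of the error
      term does not.\<close>
    have ev_C: "eventually (\<lambda>N::nat. C \<le> real N powr \<eta>) sequentially"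
      using \<eta>(1) by real_asymp
    have "eventually (\<lambda>N::nat. \<forall>c d :: int.
       0 \<le> c \<and> c < d \<and> real_of_int d \<le> C * real N powr (\<sigma> - \<eta>) \<and> gcd c d = 1 \<longrightarrow>
       \<bar>(\<Sum>n = 1..N. mangoldt_int (d * \<lfloor>\<alpha> * real n + \<beta>\<rfloor> + c))
         - inverse \<alpha> * (\<Sum>m = 1..\<lfloor>\<alpha> * real N + \<beta>\<rfloor>. mangoldt_int (d * m + c))\<bar>
       \<le> 1 * real N powr (1 - \<eta>)) sequentially"
      using ev_C ev_size ev_err ev_M eventually_gt_at_top[of 0]
    proof eventually_elim
      case (elim N)
      have "ln (2 * A) + 2 * ln (real N) = ell N" by (simp add: ell_def)
      note elim = elim[unfolded this]
      show ?case
      proof (intro allI impI)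
        fix ci di :: int
        assume H: "0 \<le> ci \<and> ci < di \<and> real_of_int di \<le> C * real N powr (\<sigma> - \<eta>) \<and> gcd ci di = 1"
        define c where "c = nat ci"
        define d where "d = nat di"
        have cdi: "ci = int c" "di = int d" using H by (auto simp: c_def d_def)
        have cd: "c < d" using H by (simp add: cdi)
        have cop: "coprime c d" using H by (simp add: cdi coprime_iff_gcd_eq_1)
        have N1: "real N \<ge> 1" using elim by simp
        have pge: "real N powr u \<ge> 1" if "u \<ge> 0" for u using N1 that by (rule ge_one_powr_ge_zero)
        have dN: "real d \<le> real N powr \<sigma>"
        proof -
          have "real d \<le> C * real N powr (\<sigma> - \<eta>)" using H by (simp add: cdi)
          also have "\<dots> \<le> real N powr \<eta> * real N powr (\<sigma> - \<eta>)" using elim by (intro mult_right_mono) auto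
          also have "\<dots> = real N powr \<sigma>" by (simp add: powr_add[symmetric])
          finally show ?thesis .
        qed
        \<comment> \<open>The factor 1/h saves N^(2\<eta>), and sqrt L, about N^(10\<eta>),
          outweighs h^3, about N^(6\<eta>), by N^(4\<eta>). Both savings beat N^\<eta> together with
          the logarithms.\<close>
        define L where "L = nat \<lceil>real N powr (20 * \<eta>)\<rceil>"
        define h where "h = nat \<lceil>real N powr (2 * \<eta>)\<rceil>"
        define M where "M = nat \<lfloor>\<alpha> * real N + \<beta>\<rfloor>"
        define l where "l = ln (real (d * M + c))"
        have L: "real N powr (20 * \<eta>) \<le> real L" "real L \<le> 2 * real N powr (20 * \<eta>)" "L > 0"
          unfolding L_def using \<eta> by (intro nat_ceiling_bounds pge; simp)+
        have h: "real N powr (2 * \<eta>) \<le> real h" "real h \<le> 2 * real N powr (2 * \<eta>)" "h > 0"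
          unfolding h_def using \<eta> by (intro nat_ceiling_bounds pge; simp)+
        have M_ge: "real N \<le> real M" and M_le: "real M \<le> A * real N" and M_eq: "int M = \<lfloor>\<alpha> * real N + \<beta>\<rfloor>"
        proof -
          have f: "of_int \<lfloor>\<alpha> * real N + \<beta>\<rfloor> \<ge> real N" using elim by linarith
          hence f0: "\<lfloor>\<alpha> * real N + \<beta>\<rfloor> \<ge> 0" using N1 by linarith
          thus M_eq: "int M = \<lfloor>\<alpha> * real N + \<beta>\<rfloor>" by (simp add: M_def)
          hence re: "real M = of_int \<lfloor>\<alpha> * real N + \<beta>\<rfloor>" by (metis of_int_of_nat_eq)
          show "real N \<le> real M" using f re by simp
          have "real M \<le> \<alpha> * real N + \<beta>" unfolding re by (rule of_int_floor_le)
          also have "\<beta> \<le> (\<bar>\<beta>\<bar> + 1) * 1" by simp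
          also have "\<dots> \<le> (\<bar>\<beta>\<bar> + 1) * real N" using N1 by (intro mult_left_mono) auto
          finally show "real M \<le> A * real N" by (simp add: A_def algebra_simps)
        qed
        have M0: "M > 0" using M_ge N1 by linarith
        have X1: "d * M + c \<ge> 1" using cd M0 by (simp add: Suc_le_eq)
        have l0: "l \<ge> 0" unfolding l_def using X1 by (intro ln_ge_zero) (simp del: of_nat_mult of_nat_add)
        have l_le: "l \<le> ell N"
        proof -
          have "d * 1 \<le> d * M" using M0 by (intro mult_le_mono) auto
          hence "d * M + c \<le> d * M + d * M" using cd by linarith
          hence "real (d * M + c) \<le> real (2 * (d * M))" by (simp only: of_nat_le_iff mult_2)
          also have "\<dots> = 2 * (real d * real M)" by simp
          also have "\<dots> \<le> 2 * (real N * (A * real N))"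
          proof (intro mult_left_mono mult_mono)
            have "real N powr \<sigma> \<le> real N powr 1" using N1 \<sigma> by (intro powr_mono) auto
            thus "real d \<le> real N" using dN N1 by simp
          qed (use M_le N1 in auto)
          finally have "l \<le> ln (2 * (real N * (A * real N)))"
            unfolding l_def using X1 A N1 by (subst ln_le_cancel_iff) (auto simp del: of_nat_mult of_nat_add)
          also have "2 * (real N * (A * real N)) = (2 * A) * (real N * real N)" by simp
          also have "ln ((2 * A) * (real N * real N)) = ell N"
            using A N1 by (simp add: ell_def ln_mult)
          finally show ?thesis .
        qed
        have h3: "real h ^ 3 \<le> 8 * real N powr (6 * \<eta>)"
        proof -
          have "real h ^ 3 \<le> (2 * real N powr (2 * \<eta>)) ^ 3" using h by (intro power_mono) auto
          also have "\<dots> = 8 * real N powr (6 * \<eta>)"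
            using N1 by (simp add: power_mult_distrib powr_power)
          finally show ?thesis .
        qed
        have HL: "real (h ^ 3) * real L \<le> 16 * real N powr (26 * \<eta>)"
        proof -
          have "real (h ^ 3) * real L \<le> (8 * real N powr (6 * \<eta>)) * (2 * real N powr (20 * \<eta>))"
            using h3 L by (intro mult_mono) auto
          also have "\<dots> = 16 * (real N powr (6 * \<eta>) * real N powr (20 * \<eta>))" by simp
          also have "real N powr (6 * \<eta>) * real N powr (20 * \<eta>) = real N powr (26 * \<eta>)"
            by (simp add: powr_add[symmetric])
          finally show ?thesis .
        qed
        have size: "9 * (real d)\<^sup>2 * real L ^ 3 * ((real (h ^ 3) * real L) powr \<theta> * (real (h ^ 3) * real L * real d) powr \<theta>) / c0\<^sup>2 \<le> real M"
        proof -
          have HLd: "real (h ^ 3) * real L * real d \<le> 16 * real N powr (26 * \<eta>) * real N powr \<sigma>"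
            by (rule mult_mono[OF HL dN]) auto
          note p1 = powr_mono2[OF less_imp_le[OF \<theta>(2)] _ HL] and p2 = powr_mono2[OF less_imp_le[OF \<theta>(2)] _ HLd]
          have "9 * (real d)\<^sup>2 * real L ^ 3 * ((real (h ^ 3) * real L) powr \<theta> * (real (h ^ 3) * real L * real d) powr \<theta>) / c0\<^sup>2
            \<le> 9 * (real N powr \<sigma>)\<^sup>2 * (2 * real N powr (20 * \<eta>)) ^ 3 * ((16 * real N powr (26 * \<eta>)) powr \<theta> * (16 * real N powr (26 * \<eta>) * real N powr \<sigma>) powr \<theta>) / c0\<^sup>2"
            using dN L by (intro divide_right_mono mult_mono power_mono p1 p2) auto
          also have "\<dots> = K1 * ((real N powr \<sigma>)\<^sup>2 * (real N powr (20 * \<eta>)) ^ 3 * ((real N powr (26 * \<eta>)) powr \<theta> * ((real N powr (26 * \<eta>)) powr \<theta> * (real N powr \<sigma>) powr \<theta>)))"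
            by (simp add: K1_def powr_mult power_mult_distrib mult_ac)
          also have "(real N powr \<sigma>)\<^sup>2 * (real N powr (20 * \<eta>)) ^ 3 * ((real N powr (26 * \<eta>)) powr \<theta> * ((real N powr (26 * \<eta>)) powr \<theta> * (real N powr \<sigma>) powr \<theta>)) = real N powr e"
            using N1 by (simp add: powr_power powr_powr powr_add[symmetric] e_def algebra_simps)
          also have "K1 * \<dots> \<le> real N" using elim by simp
          finally show ?thesis using M_ge by linarith
        qed
        have sqrtL: "real N powr (10 * \<eta>) \<le> sqrt (real L)"
        proof (rule real_le_rsqrt)
          show "(real N powr (10 * \<eta>))\<^sup>2 \<le> real L" using L N1 by (simp add: powr_power)
        qed
        have "\<bar>(\<Sum>n = 1..N. mangoldt_int (di * \<lfloor>\<alpha> * real n + \<beta>\<rfloor> + ci))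
             - inverse \<alpha> * (\<Sum>m = 1..\<lfloor>\<alpha> * real N + \<beta>\<rfloor>. mangoldt_int (di * m + ci))\<bar>
           \<le> (\<bar>\<beta>\<bar> + 1) * l + 8 * (real M * l) / real h + real h ^ 3 * (16 * (1 + l)\<^sup>2 * real M / sqrt (real L) + l)"
          unfolding cdi l_def
          by (rule beatty_progression_le[OF assms(1) cop cd L(3) h(3) M0 M_eq \<theta>(2) c0 size])
        also have "\<dots> = (\<bar>\<beta>\<bar> + 1) * l + 8 * (real M * l) / real h + real h ^ 3 * (16 * (1 + l)\<^sup>2 * real M / sqrt (real L)) + real h ^ 3 * l"
          by (simp add: distrib_left)
        also have "\<dots> \<le> real N powr (1 - \<eta>) / 4 + real N powr (1 - \<eta>) / 4 + real N powr (1 - \<eta>) / 4 + real N powr (1 - \<eta>) / 4"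
        proof (intro add_mono)
          have "(\<bar>\<beta>\<bar> + 1) * l \<le> (\<bar>\<beta>\<bar> + 1) * ell N" using l_le by (intro mult_left_mono) auto
          thus "(\<bar>\<beta>\<bar> + 1) * l \<le> real N powr (1 - \<eta>) / 4" using elim by linarith
          have "8 * (real M * l) / real h \<le> 8 * ((A * real N) * ell N) / real N powr (2 * \<eta>)"
            using M_le l_le l0 h N1 A by (intro frac_le mult_left_mono mult_mono) auto
          also have "\<dots> = 8 * A * ell N * (real N / real N powr (2 * \<eta>))" by simp
          also have "real N / real N powr (2 * \<eta>) = real N powr (1 - 2 * \<eta>)"
            using N1 by (simp add: powr_diff)
          finally show "8 * (real M * l) / real h \<le> real N powr (1 - \<eta>) / 4" using elim by linarith
          have "real h ^ 3 * (16 * (1 + l)\<^sup>2 * real M / sqrt (real L)) \<le>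
              (8 * real N powr (6 * \<eta>)) * (16 * (1 + ell N)\<^sup>2 * (A * real N) / real N powr (10 * \<eta>))"
            using h3 l_le l0 M_le sqrtL N1 A by (intro mult_mono frac_le power_mono) auto
          also have "\<dots> = 128 * A * (1 + ell N)\<^sup>2 * (real N powr (6 * \<eta>) * real N / real N powr (10 * \<eta>))"
            by simp
          also have "real N powr (6 * \<eta>) * real N / real N powr (10 * \<eta>) = real N powr (1 - 4 * \<eta>)"
          proof -
            have "real N powr (6 * \<eta>) * real N powr 1 / real N powr (10 * \<eta>) = real N powr (6 * \<eta> + 1 - 10 * \<eta>)"
              by (simp only: powr_add powr_diff)
            thus ?thesis using N1 by simp
          qed
          finally show "real h ^ 3 * (16 * (1 + l)\<^sup>2 * real M / sqrt (real L)) \<le> real N powr (1 - \<eta>) / 4"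
            using elim by linarith
          have "real h ^ 3 * l \<le> 8 * real N powr (6 * \<eta>) * ell N"
            using h3 l_le l0 by (intro mult_mono) auto
          thus "real h ^ 3 * l \<le> real N powr (1 - \<eta>) / 4" using elim by linarith
        qed
        also have "\<dots> = 1 * real N powr (1 - \<eta>)" by simp
        finally show "\<bar>(\<Sum>n = 1..N. mangoldt_int (di * \<lfloor>\<alpha> * real n + \<beta>\<rfloor> + ci))
             - inverse \<alpha> * (\<Sum>m = 1..\<lfloor>\<alpha> * real N + \<beta>\<rfloor>. mangoldt_int (di * m + ci))\<bar> \<le> 1 * real N powr (1 - \<eta>)" .
      qed
    qed
    thus ?thesis by (simp only: eventually_sequentially)
  qed
  show ?thesis
    unfolding \<sigma>_def[symmetric] using \<eta>(1,3) main
    by (intro exI[of _ \<eta>] conjI exI[of _ "1::real"] allI impI) auto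
qed

end
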